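(* Let $K=K_1\cup\dots\cup K_s\subset\mathbb{R}^N$ ($N\ge 2$, $s\ge 3$) be an open billiard configuration with symbol space $\Sigma$, shift $\sigma$, and observable $\phi:\Sigma\to\mathbb{R}^N$ given by the starting point of the coded billiard trajectory. Then the closure of the pointwise rotation set $J_\phi$ is convex, and the set $P_\phi$ is dense in $J_\phi$.
   Context: An open billiard configuration: $K_1,\dots,K_s$ are pairwise disjoint compact strictly convex subsets of $\mathbb{R}^N$ with $C^2$-smooth boundaries, satisfying the no-eclipse condition: for any pairwise distinct $i,j,k$, the convex hull of $K_i\cup K_j$ does not intersect $K_k$. The billiard takes place in $\mathbb{R}^N\setminus K$ with specular reflection. $\Sigma$ is the set of bi-infinite sequences $(\xi_i)_{i\in\mathbb{Z}}$ with $\xi_i\in\{1,\dots,s\}$, $\xi_i\ne\xi_{i+1}$; $(\sigma\xi)_i=\xi_{i+1}$. For each $\xi\in\Sigma$ there is a unique $(y,v)$, $y\in\partial K$, $v$ a unit vector, such that the billiard trajectory from $y$ in direction $v$ reflects infinitely often forwards and backwards with $i$-th reflection at $\partial K_{\xi_i}$ for all $i\in\mathbb{Z}$ (the $0$-th at $y$); $\phi(\xi)=y$. The rotation vector $\rho_\phi(\xi)=\lim_{n\to\infty}\frac1n\sum_{i=0}^{n-1}\phi(\sigma^i\xi)$ is defined when the limit exists; $J_\phi$ is the set of all such limits over $\xi\in\Sigma$. $\xi$ is periodic if $\sigma^p\xi=\xi$ for some $p>0$. $P_\phi$ is the set of all convex combinations $\sum_{i=1}^k t_i\rho_\phi(\xi_i)$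 of rotation vectors of periodic elements $\xi_1,\dots,\xi_k$ of $\Sigma$. *)

theory Defs
  imports "HOL-Analysis.Analysis"
begin

definition strictly_convex :: "'a::euclidean_space set \<Rightarrow> bool" where
  "strictly_convex K \<longleftrightarrow> convex K \<and>
     (\<forall>x\<in>K. \<forall>y\<in>K. x \<noteq> y \<longrightarrow> open_segment x y \<subseteq> interior K)"

definition C2_boundary :: "'a::euclidean_space set \<Rightarrow> bool" where
  "C2_boundary K \<longleftrightarrow> (\<forall>p\<in>frontier K. \<exists>U (F::'a \<Rightarrow> real) (G::'a \<Rightarrow> 'a) (G'::'a \<Rightarrow> ('a \<Rightarrow>\<^sub>L 'a)).
      open U \<and> p \<in> U \<and>
      (\<forall>x\<in>U. (F has_derivative (\<lambda>h. G x \<bullet> h)) (at x)) \<and>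
      (\<forall>x\<in>U. (G has_derivative blinfun_apply (G' x)) (at x)) \<and>
      continuous_on U G' \<and>
      (\<forall>x\<in>U. G x \<noteq> 0) \<and>
      K \<inter> U = {x\<in>U. F x \<le> 0})"

definition open_billiard_config :: "nat \<Rightarrow> (nat \<Rightarrow> 'a::euclidean_space set) \<Rightarrow> bool" where
  "open_billiard_config s K \<longleftrightarrow>
     (\<forall>i\<in>{1..s}. K i \<noteq> {} \<and> compact (K i) \<and> strictly_convex (K i) \<and> C2_boundary (K i)) \<and>
     (\<forall>i\<in>{1..s}. \<forall>j\<in>{1..s}. i \<noteq> j \<longrightarrow> K i \<inter> K j = {}) \<and>
     (\<forall>i\<in>{1..s}. \<forall>j\<in>{1..s}. \<forall>k\<in>{1..s}. i \<noteq> j \<and> i \<noteq> k \<and> j \<noteq> k \<longrightarrow>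
         convex hull (K i \<union> K j) \<inter> K k = {})"

definition Sigma_sym :: "nat \<Rightarrow> (int \<Rightarrow> nat) set" where
  "Sigma_sym s = {\<xi>. (\<forall>i. \<xi> i \<in> {1..s}) \<and> (\<forall>i. \<xi> i \<noteq> \<xi> (i + 1))}"

definition shift :: "(int \<Rightarrow> nat) \<Rightarrow> (int \<Rightarrow> nat)" where
  "shift \<xi> = (\<lambda>i. \<xi> (i + 1))"

definition periodic_seq :: "(int \<Rightarrow> nat) \<Rightarrow> bool" where
  "periodic_seq \<xi> \<longleftrightarrow> (\<exists>p::nat. p > 0 \<and> (shift ^^ p) \<xi> = \<xi>)"

definition outer_normal :: "'a::euclidean_space set \<Rightarrow> 'a \<Rightarrow> 'a \<Rightarrow> bool" where
  "outer_normal K p \<nu> \<longleftrightarrow> norm \<nu> = 1 \<and> (\<forall>z\<in>K. \<nu> \<bullet> (z - p) \<le> 0)"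

text \<open>x is the sequence of reflection points of a billiard trajectory in the complement of
  K_1 \<union> ... \<union> K_s whose i-th reflection is at the boundary of K_(\<xi> i); free flight
  between reflections avoids K; specular reflection law at every reflection point.\<close>
definition billiard_orbit ::
  "nat \<Rightarrow> (nat \<Rightarrow> 'a::euclidean_space set) \<Rightarrow> (int \<Rightarrow> nat) \<Rightarrow> (int \<Rightarrow> 'a) \<Rightarrow> bool" where
  "billiard_orbit s K \<xi> x \<longleftrightarrow>
     (\<forall>i. x i \<in> frontier (K (\<xi> i))) \<and>
     (\<forall>i. x i \<noteq> x (i + 1)) \<and>
     (\<forall>i. open_segment (x i) (x (i + 1)) \<inter> (\<Union>j\<in>{1..s}. K j) = {}) \<and>
     (\<forall>i. \<exists>\<nu>. outer_normal (K (\<xi> i)) (x i) \<nu> \<and>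
          sgn (x (i + 1) - x i) =
            sgn (x i - x (i - 1)) - (2 * (sgn (x i - x (i - 1)) \<bullet> \<nu>)) *\<^sub>R \<nu>)"

definition phi_billiard :: "nat \<Rightarrow> (nat \<Rightarrow> 'a::euclidean_space set) \<Rightarrow> (int \<Rightarrow> nat) \<Rightarrow> 'a" where
  "phi_billiard s K \<xi> = (THE y. \<exists>x. billiard_orbit s K \<xi> x \<and> x 0 = y)"

definition has_rotation_vector ::
  "nat \<Rightarrow> (nat \<Rightarrow> 'a::euclidean_space set) \<Rightarrow> (int \<Rightarrow> nat) \<Rightarrow> 'a \<Rightarrow> bool" where
  "has_rotation_vector s K \<xi> r \<longleftrightarrow>
     ((\<lambda>n. (1 / real n) *\<^sub>R (\<Sum>i<n. phi_billiard s K ((shift ^^ i) \<xi>))) \<longlongrightarrow> r) sequentially"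

definition J_phi :: "nat \<Rightarrow> (nat \<Rightarrow> 'a::euclidean_space set) \<Rightarrow> 'a set" where
  "J_phi s K = {r. \<exists>\<xi>\<in>Sigma_sym s. has_rotation_vector s K \<xi> r}"

definition P_phi :: "nat \<Rightarrow> (nat \<Rightarrow> 'a::euclidean_space set) \<Rightarrow> 'a set" where
  "P_phi s K = convex hull {r. \<exists>\<xi>\<in>Sigma_sym s. periodic_seq \<xi> \<and> has_rotation_vector s K \<xi> r}"

end

(* The length of a polygonal path is a convex function of its vertices, and billiard orbits with
   itinerary \<xi> are exactly its critical points on the product of the convex sets K (\<xi> i): the
   bend of the path at x i, paired with any displacement inside K (\<xi> i), is nonnegative.
   Existence follows by minimising length. If x and y are two critical orbits whose itineraries
   agree on a long block around 0, then summation by parts bounds the (nonnegative) sum of these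
   pairings with y - x and x - y by boundary terms. By pigeonhole the pairings are small at some
   indices on both sides of 0; strict convexity and the no-eclipse condition make y - x small
   there, and using those indices as new end points makes y - x small at 0. So the orbit is unique
   and depends uniformly continuously on the itinerary.
   Hence the average of phi along a long periodic itinerary concatenating a block of \<xi> and an
   equally long block of \<eta> is close to the midpoint of the rotation vectors of \<xi> and \<eta>. *)
theory Submission
  imports Defs
begin

subsection \<open>Convexity of the length functional\<close>

text \<open>The gradient in \<open>q\<close> of \<open>norm (q - p) + norm (q - r)\<close>, as long
  as \<open>q\<close> differs from \<open>p\<close> and \<open>r\<close>. It vanishes when the path
  passes straight through \<open>q\<close>.\<close>

definition bend :: "'a::real_inner \<Rightarrow> 'a \<Rightarrow> 'a \<Rightarrow> 'a" where
  "bend p q r = sgn (q - p) + sgn (q - r)"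

text \<open>The first-order condition for minimising the two adjacent edge lengths over a convex
  set. As a family of weak inequalities it survives limits, which the compactness arguments rely
  on.\<close>

definition critical_at :: "(int \<Rightarrow> 'a::real_inner set) \<Rightarrow> (int \<Rightarrow> 'a) \<Rightarrow> int \<Rightarrow> bool" where
  "critical_at S x i \<longleftrightarrow> (\<forall>z\<in>S i. bend (x (i - 1)) (x i) (x (i + 1)) \<bullet> (z - x i) \<ge> 0)"

lemma inner_sgn_self: "sgn a \<bullet> a = norm (a::'a::real_inner)"
  by (cases "a = 0") (simp_all add: sgn_div_norm dot_square_norm power2_eq_square)

lemma norm_sgn_le_1: "norm (sgn (a::'a::real_normed_vector)) \<le> 1"
  by (simp add: norm_sgn)

lemma inner_sgn_le: "sgn a \<bullet> b \<le> norm (b::'a::real_inner)"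
proof -
  have "sgn a \<bullet> b \<le> norm (sgn a) * norm b" by (rule norm_cauchy_schwarz)
  also have "\<dots> \<le> 1 * norm b" by (rule mult_right_mono[OF norm_sgn_le_1]) simp
  finally show ?thesis by simp
qed

lemma sgn_monotone: "(sgn a - sgn b) \<bullet> (a - b) \<ge> (0::real)" for a b :: "'a::real_inner"
  using inner_sgn_le[of a b] inner_sgn_le[of b a] inner_sgn_self[of a] inner_sgn_self[of b]
  by (simp add: inner_diff_left inner_diff_right)

lemma inner_sgn_diff_le: "(sgn a - sgn b) \<bullet> d \<le> 2 * norm d" for a b d :: "'a::real_inner"
  using inner_sgn_le[of a d] inner_sgn_le[of b "- d"]
  by (simp add: inner_diff_left inner_diff_right)

text \<open>The subgradient inequality of the norm at the displaced point, read at \<open>a\<close>.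
  Taking the slope at the far end turns it into an upper bound for the increment.\<close>

lemma norm_add_scaled_le: "norm (a + t *\<^sub>R h) \<le> norm a + t * (sgn (a + t *\<^sub>R h) \<bullet> h)"
  for a h :: "'a::real_inner"
  using inner_sgn_le[of "a + t *\<^sub>R h" a] inner_sgn_self[of "a + t *\<^sub>R h"]
  by (simp add: inner_add_right)

lemma bend_alt: "bend p q r = sgn (q - p) - sgn (r - q)"
  unfolding bend_def using sgn_minus[of "r - q"] by simp

text \<open>Moving \<open>q\<close> towards \<open>z\<close> by a fraction \<open>t\<close> adds at
  most \<open>t * g t\<close> to the length, so minimality forces \<open>g t \<ge> 0\<close>; then
  \<open>t\<close> tends to 0.\<close>

lemma minimizer_bend:
  fixes p q r z :: "'a::real_inner"
  assumes "q \<noteq> p" "q \<noteq> r"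
    and min: "\<And>t. 0 < t \<Longrightarrow> t \<le> 1 \<Longrightarrow>
      norm (q - p) + norm (q - r) \<le> norm (q + t *\<^sub>R (z - q) - p) + norm (q + t *\<^sub>R (z - q) - r)"
  shows "bend p q r \<bullet> (z - q) \<ge> 0"
proof -
  define h where "h = z - q"
  define g where "g t = (sgn (q - p + t *\<^sub>R h) + sgn (q - r + t *\<^sub>R h)) \<bullet> h" for t :: real
  \<comment> \<open>\<open>sgn\<close> is discontinuous at 0, so this limit rests on
    \<open>q\<close> differing from both neighbours.\<close>
  have "(g \<longlongrightarrow> (sgn (q - p + 0 *\<^sub>R h) + sgn (q - r + 0 *\<^sub>R h)) \<bullet> h) (at_right 0)"
    unfolding g_def using assms(1,2) by (intro tendsto_intros) auto
  hence lim: "(g \<longlongrightarrow> bend p q r \<bullet> h) (at_right 0)"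
    by (simp add: bend_def)
  have nn: "g t \<ge> 0" if t: "0 < t" "t \<le> 1" for t
  proof -
    have "norm (q - p) + norm (q - r) \<le> norm (q - p + t *\<^sub>R h) + norm (q - r + t *\<^sub>R h)"
      using min[OF t] by (simp add: h_def algebra_simps)
    also have "\<dots> \<le> norm (q - p) + norm (q - r) + t * g t"
      using norm_add_scaled_le[of "q - p" t h] norm_add_scaled_le[of "q - r" t h]
      by (simp add: g_def algebra_simps)
    finally have "0 \<le> t * g t" by simp
    thus ?thesis using t by (simp add: zero_le_mult_iff)
  qed
  have "\<forall>\<^sub>F t in at_right (0::real). 0 \<le> g t"
    unfolding eventually_at_right_field by (intro exI[of _ 1]) (auto intro: nn)
  hence "0 \<le> bend p q r \<bullet> h"
    using tendsto_lowerbound[OF lim] trivial_limit_at_right_real by blast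
  thus ?thesis by (simp add: h_def)
qed

text \<open>The competitor moves a single vertex, and edge \<open>k\<close> joins the vertices
  \<open>k\<close> and \<open>k + 1\<close>; hence both \<open>i - 1\<close> and \<open>i\<close>
  must be counted in \<open>I\<close>. Disjoint consecutive sets keep the edges
  nondegenerate.\<close>

lemma length_minimizer_critical:
  fixes S :: "int \<Rightarrow> 'a::real_inner set"
  assumes S: "\<And>i. convex (S i)" and disj: "\<And>i. S i \<inter> S (i + 1) = {}" and x: "\<And>i. x i \<in> S i"
    and min: "\<And>y. (\<And>i. y i \<in> S i) \<Longrightarrow>
      (\<Sum>i\<in>I. norm (x (i + 1) - x i)) \<le> (\<Sum>i\<in>I. norm (y (i + 1) - y i))"
    and I: "finite I" "i \<in> I" "i - 1 \<in> I"
  shows "critical_at S x (i :: int)"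
  unfolding critical_at_def
proof
  fix z assume z: "z \<in> S i"
  show "0 \<le> bend (x (i - 1)) (x i) (x (i + 1)) \<bullet> (z - x i)"
  proof (rule minimizer_bend)
    show "x i \<noteq> x (i - 1)" "x i \<noteq> x (i + 1)"
      using x[of "i - 1"] x[of i] x[of "i + 1"] disj[of i] disj[of "i - 1"] by auto
    fix t :: real assume t: "0 < t" "t \<le> 1"
    define y where "y = x(i := x i + t *\<^sub>R (z - x i))"
    have "x i + t *\<^sub>R (z - x i) = (1 - t) *\<^sub>R x i + t *\<^sub>R z" by (simp add: algebra_simps)
    hence "x i + t *\<^sub>R (z - x i) \<in> S i"
      using convexD[OF S x[of i] z, of "1 - t" t] t by simp
    hence "y k \<in> S k" for k using x[of k] by (simp add: y_def)
    hence le: "(\<Sum>k\<in>I. norm (x (k + 1) - x k)) \<le> (\<Sum>k\<in>I. norm (y (k + 1) - y k))" by (rule min)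
    have split: "(\<Sum>k\<in>I. g k) = (\<Sum>k\<in>I - {i - 1, i}. g k) + (g (i - 1) + g i)" for g :: "int \<Rightarrow> real"
      using I by (subst sum.subset_diff[of "{i - 1, i}" I]) auto
    have rest: "(\<Sum>k\<in>I - {i - 1, i}. norm (y (k + 1) - y k))
      = (\<Sum>k\<in>I - {i - 1, i}. norm (x (k + 1) - x k))"
      by (intro sum.cong) (auto simp: y_def)
    have "norm (x i - x (i - 1)) + norm (x (i + 1) - x i)
      \<le> norm (y i - x (i - 1)) + norm (x (i + 1) - y i)"
      using le unfolding split rest by (simp add: y_def)
    thus "norm (x i - x (i - 1)) + norm (x i - x (i + 1))
      \<le> norm (x i + t *\<^sub>R (z - x i) - x (i - 1)) + norm (x i + t *\<^sub>R (z - x i) - x (i + 1))"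
      by (simp add: y_def norm_minus_commute)
  qed
qed

text \<open>The derivative of the length at \<open>x\<close> when vertex \<open>i\<close> alone
  moves towards \<open>y i\<close>; nonnegative if \<open>x\<close> is critical at \<open>i\<close>
  and \<open>y i\<close> lies in the same obstacle.\<close>

definition bend_gap :: "(int \<Rightarrow> 'a::real_inner) \<Rightarrow> (int \<Rightarrow> 'a) \<Rightarrow> int \<Rightarrow> real" where
  "bend_gap x y i = bend (x (i - 1)) (x i) (x (i + 1)) \<bullet> (y i - x i)"

text \<open>Summation by parts; the interior terms have a sign because the gradient of the norm is
  monotone.\<close>

lemma sum_bend_gap_le:
  fixes x y :: "int \<Rightarrow> 'a::real_inner"
  shows "(\<Sum>i\<in>{1..n}. bend_gap x y (j + int i) + bend_gap y x (j + int i))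
    \<le> 2 * norm (y j - x j) + 2 * norm (y (j + int n + 1) - x (j + int n + 1))"
proof -
  define D where "D i = (sgn (y (i + 1) - y i) - sgn (x (i + 1) - x i))" for i
  define d where "d i = y i - x i" for i
  \<comment> \<open>The edge vectors of \<open>y\<close> and \<open>x\<close> at \<open>i\<close>
    differ by \<open>d (i + 1) - d i\<close>, and \<open>D i\<close> is the difference of their
    directions.\<close>
  have mono: "D i \<bullet> d i \<le> D i \<bullet> d (i + 1)" for i
    using sgn_monotone[of "y (i + 1) - y i" "x (i + 1) - x i"]
    by (simp add: D_def d_def inner_diff_right)
  have gaps: "bend_gap x y i + bend_gap y x i = D i \<bullet> d i - D (i - 1) \<bullet> d i" for i
    by (simp add: bend_gap_def bend_alt D_def d_def inner_diff_left inner_diff_right)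
  have "(\<Sum>i\<in>{1..n}. bend_gap x y (j + int i) + bend_gap y x (j + int i))
    \<le> D (j + int n) \<bullet> d (j + int n + 1) - D j \<bullet> d j"
  proof (induction n)
    case 0
    show ?case using mono[of j] by simp
  next
    case (Suc n)
    have "j + int (Suc n) = j + int n + 1" "j + int (Suc n) - 1 = j + int n" by simp_all
    thus ?case using Suc mono[of "j + int (Suc n)"] gaps[of "j + int (Suc n)"] by (simp add: ac_simps)
  qed
  moreover have "D (j + int n) \<bullet> d (j + int n + 1) \<le> 2 * norm (d (j + int n + 1))"
    unfolding D_def by (rule inner_sgn_diff_le)
  moreover have "- (D j \<bullet> d j) \<le> 2 * norm (d j)"
    using inner_sgn_diff_le[of "y (j + 1) - y j" "x (j + 1) - x j" "- d j"]
    by (simp add: D_def)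
  ultimately show ?thesis by (simp add: d_def)
qed

subsection \<open>Critical points and billiard orbits\<close>

text \<open>A vanishing bend means equal incoming and outgoing directions, so \<open>q\<close>
  divides the segment in the ratio of the two edge lengths.\<close>

lemma sgn_eq_between:
  fixes p q r :: "'a::real_inner"
  assumes "q \<noteq> p" "q \<noteq> r" "bend p q r = 0"
  shows "q \<in> closed_segment p r"
proof -
  define a b where "a = norm (q - p)" and "b = norm (r - q)"
  have ab: "a > 0" "b > 0" using assms by (auto simp: a_def b_def)
  have "sgn (q - p) = sgn (r - q)" using assms(3) by (simp add: bend_alt)
  hence "inverse a *\<^sub>R (q - p) = inverse b *\<^sub>R (r - q)"
    by (simp add: sgn_div_norm a_def b_def)
  hence "(a * b) *\<^sub>R (inverse a *\<^sub>R (q - p)) = (a * b) *\<^sub>R (inverse b *\<^sub>R (r - q))" by simp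
  moreover have "a * b * inverse a = b" "a * b * inverse b = a" using ab by simp_all
  ultimately have "b *\<^sub>R (q - p) = a *\<^sub>R (r - q)" unfolding scaleR_scaleR by simp
  hence e: "(a + b) *\<^sub>R q = b *\<^sub>R p + a *\<^sub>R r" by (simp add: algebra_simps)
  have "q = inverse (a + b) *\<^sub>R ((a + b) *\<^sub>R q)" using ab by simp
  also have "\<dots> = (b / (a + b)) *\<^sub>R p + (a / (a + b)) *\<^sub>R r"
    unfolding e by (simp add: scaleR_add_right divide_inverse mult.commute)
  also have "b / (a + b) = 1 - a / (a + b)" using ab by (simp add: field_simps)
  finally show ?thesis using ab unfolding in_segment
    by (intro exI[of _ "a / (a + b)"]) (auto simp: field_simps)
qed

text \<open>Were the product 0, \<open>w\<close> would attain its minimum over \<open>K\<close> at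
  both \<open>q\<close> and \<open>q'\<close>, hence also at their midpoint. That point is interior,
  so the minimum could be lowered.\<close>

lemma strictly_convex_critical_unique:
  fixes q q' w :: "'a::euclidean_space"
  assumes sc: "strictly_convex K" and q: "q \<in> K" "q' \<in> K" "q \<noteq> q'" and w: "w \<noteq> 0"
    and vi: "\<And>z. z \<in> K \<Longrightarrow> w \<bullet> (z - q) \<ge> 0"
  shows "w \<bullet> (q' - q) > 0"
proof (rule ccontr)
  assume "\<not> ?thesis"
  hence 0: "w \<bullet> (q' - q) = 0" using vi[OF q(2)] by simp
  have "midpoint q q' \<in> open_segment q q'" using q by simp
  hence "midpoint q q' \<in> interior K" using sc q unfolding strictly_convex_def by blast
  then obtain e where e: "e > 0" "cball (midpoint q q') e \<subseteq> K"
    by (metis mem_interior_cball)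
  \<comment> \<open>The midpoint pushed by \<open>e\<close> against \<open>w\<close>, still inside
    the ball.\<close>
  define z where "z = midpoint q q' - (e / norm w) *\<^sub>R w"
  have "z \<in> K" using e w by (intro subsetD[OF e(2)]) (simp add: z_def dist_norm)
  hence "w \<bullet> (z - q) \<ge> 0" by (rule vi)
  moreover
  have "z - q = (1/2) *\<^sub>R (q' - q) - (e / norm w) *\<^sub>R w"
    by (simp add: z_def midpoint_def algebra_simps flip: scaleR_left_distrib)
  hence "w \<bullet> (z - q) = 1 / 2 * (w \<bullet> (q' - q)) - e / norm w * (w \<bullet> w)"
    by (simp only: inner_diff_right inner_scaleR_right)
  ultimately have "e / norm w * (w \<bullet> w) \<le> 0" using 0 by linarith
  moreover have "e / norm w * (w \<bullet> w) > 0" using e w by simp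
  ultimately show False by linarith
qed

text \<open>Here \<open>g\<close> is the gradient of a local defining function \<open>F\<close>.
  Since \<open>F p \<le> 0\<close>, a direction of negative derivative enters the sublevel set at
  once.\<close>

lemma C2_boundary_descent:
  fixes p :: "'a::euclidean_space"
  assumes "C2_boundary K" "p \<in> frontier K" "p \<in> K"
  obtains g where "g \<noteq> 0"
    "\<And>h t0. g \<bullet> h < 0 \<Longrightarrow> 0 < t0 \<Longrightarrow> \<exists>t. 0 < t \<and> t < t0 \<and> p + t *\<^sub>R h \<in> K"
proof -
  obtain U and F :: "'a \<Rightarrow> real" and G :: "'a \<Rightarrow> 'a" where U: "open U" "p \<in> U"
    and F: "(F has_derivative (\<lambda>h. G p \<bullet> h)) (at p)" and G: "G p \<noteq> 0"
    and KU: "K \<inter> U = {x\<in>U. F x \<le> 0}"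
    using bspec[OF assms(1)[unfolded C2_boundary_def] assms(2)] by (elim exE conjE) blast
  have "\<exists>t. 0 < t \<and> t < t0 \<and> p + t *\<^sub>R h \<in> K" if h: "G p \<bullet> h < 0" and t0: "0 < t0" for h t0
  proof -
    have "((\<lambda>t. F (p + t *\<^sub>R h)) has_derivative (\<lambda>t. G p \<bullet> (t *\<^sub>R h))) (at 0)"
      by (rule has_derivative_compose[where f = "\<lambda>t. p + t *\<^sub>R h" and g = F])
        (use F in \<open>auto intro!: derivative_eq_intros\<close>)
    hence "DERIV (\<lambda>t. F (p + t *\<^sub>R h)) 0 :> G p \<bullet> h"
      unfolding has_field_derivative_def by (rule has_derivative_eq_rhs) (simp add: mult.commute fun_eq_iff)
    from DERIV_neg_dec_right[OF this h]
    obtain d where d: "d > 0" "\<And>t. 0 < t \<Longrightarrow> t < d \<Longrightarrow> F (p + t *\<^sub>R h) < F p" by auto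
    have "((\<lambda>t. p + t *\<^sub>R h) \<longlongrightarrow> p + 0 *\<^sub>R h) (at_right (0::real))" by (intro tendsto_intros)
    hence "\<forall>\<^sub>F t in at_right (0::real). p + t *\<^sub>R h \<in> U"
      using U by (intro topological_tendstoD) auto
    then obtain e where e: "e > 0" "\<And>t. 0 < t \<Longrightarrow> t < e \<Longrightarrow> p + t *\<^sub>R h \<in> U"
      unfolding eventually_at_right_field by blast
    define t where "t = min t0 (min d e) / 2"
    have t: "0 < t" "t < t0" "t < d" "t < e" using t0 d(1) e(1) by (auto simp: t_def)
    have "F p \<le> 0" using assms(3) U KU by blast
    hence "p + t *\<^sub>R h \<in> K \<inter> U" using d(2)[of t] e(2)[of t] t unfolding KU by auto
    thus ?thesis using t by blast
  qed
  thus ?thesis using that G by blast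
qed

text \<open>Smoothness enters only here: a free flight arriving at a boundary point comes from the
  outer side of the supporting hyperplane.\<close>

lemma outer_normal_incoming:
  fixes p u :: "'a::euclidean_space"
  assumes "C2_boundary K" "p \<in> frontier K" "p \<in> K" and \<nu>: "outer_normal K p \<nu>"
    and out: "\<And>t. 0 < t \<Longrightarrow> t < 1 \<Longrightarrow> p - t *\<^sub>R u \<notin> K"
  shows "\<nu> \<bullet> u \<le> 0"
proof -
  obtain g where g: "g \<noteq> 0"
    and desc: "\<And>h t0. g \<bullet> h < 0 \<Longrightarrow> 0 < t0 \<Longrightarrow> \<exists>t. 0 < t \<and> t < t0 \<and> p + t *\<^sub>R h \<in> K"
    using C2_boundary_descent[OF assms(1-3)] by blast
  \<comment> \<open>Otherwise \<open>- u\<close> would be a descent direction and the incoming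
    flight would meet \<open>K\<close> just before \<open>p\<close>.\<close>
  have gu: "g \<bullet> u \<le> 0"
    using desc[of "- u" 1] out by (force simp: not_less[symmetric])
  \<comment> \<open>Tilting \<open>u\<close> by \<open>- \<delta> *\<^sub>R g\<close> makes the
    descent strict and yields a point of \<open>K\<close>, to which the supporting hyperplane
    applies; \<delta> is then sent to 0.\<close>
  have "\<nu> \<bullet> u \<le> \<delta> * (\<nu> \<bullet> g)" if "\<delta> > 0" for \<delta>
  proof -
    have "g \<bullet> (u - \<delta> *\<^sub>R g) < 0"
      using gu g that by (simp add: inner_diff_right add.commute add_strict_increasing2 less_le_trans le_less_trans)
    from desc[OF this, of 1] obtain t where t: "t > 0" "p + t *\<^sub>R (u - \<delta> *\<^sub>R g) \<in> K" by auto
    hence "t * (\<nu> \<bullet> (u - \<delta> *\<^sub>R g)) \<le> 0" using \<nu> unfolding outer_normal_def by fastforce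
    thus ?thesis using t(1) by (simp add: mult_le_0_iff inner_diff_right)
  qed
  hence "\<forall>\<^sub>F \<delta> in at_right 0. \<nu> \<bullet> u \<le> \<delta> * (\<nu> \<bullet> g)"
    unfolding eventually_at_right_field by (intro exI[of _ 1]) auto
  moreover have "((\<lambda>\<delta>. \<delta> * (\<nu> \<bullet> g)) \<longlongrightarrow> 0 * (\<nu> \<bullet> g)) (at_right 0)" by (intro tendsto_intros)
  ultimately have "\<nu> \<bullet> u \<le> 0 * (\<nu> \<bullet> g)"
    using tendsto_lowerbound trivial_limit_at_right_real by blast
  thus ?thesis by simp
qed

text \<open>The hyperplane orthogonal to \<open>a - b\<close> is the mirror that exchanges the unit
  vectors \<open>a\<close> and \<open>b\<close>; this is how the bend encodes specular
  reflection.\<close>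

lemma unit_diff_inner:
  fixes a b :: "'a::real_inner"
  assumes "norm a = 1" "norm b = 1"
  shows "(a - b) \<bullet> a = (norm (a - b))\<^sup>2 / 2" "(a - b) \<bullet> b = - (norm (a - b))\<^sup>2 / 2"
proof -
  have "a \<bullet> a = 1" "b \<bullet> b = 1" using assms by (simp_all add: norm_eq_1)
  thus "(a - b) \<bullet> a = (norm (a - b))\<^sup>2 / 2" "(a - b) \<bullet> b = - (norm (a - b))\<^sup>2 / 2"
    by (simp_all add: power2_norm_eq_inner inner_diff_left inner_diff_right inner_commute)
qed

lemma norm_sgn_1: "a \<noteq> 0 \<Longrightarrow> norm (sgn (a::'a::real_normed_vector)) = 1"
  by (simp add: norm_sgn)

definition critical_orbit :: "(int \<Rightarrow> 'a::real_inner set) \<Rightarrow> (int \<Rightarrow> 'a) \<Rightarrow> bool" where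
  "critical_orbit S x \<longleftrightarrow> (\<forall>i. x i \<in> S i \<and> critical_at S x i)"

lemma Sigma_symD:
  assumes "\<xi> \<in> Sigma_sym s"
  shows "\<xi> i \<in> {1..s}" "\<xi> i \<noteq> \<xi> (i + 1)" "\<xi> (i + 1) \<noteq> \<xi> i" "\<xi> (i - 1) \<noteq> \<xi> i" "\<xi> i \<noteq> \<xi> (i - 1)"
proof -
  have *: "\<xi> i \<in> {1..s}" "\<xi> i \<noteq> \<xi> (i + 1)" for i using assms unfolding Sigma_sym_def by blast+
  show "\<xi> i \<in> {1..s}" "\<xi> i \<noteq> \<xi> (i + 1)" "\<xi> (i + 1) \<noteq> \<xi> i" "\<xi> (i - 1) \<noteq> \<xi> i" "\<xi> i \<noteq> \<xi> (i - 1)"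
    using *[of i] *(2)[of "i - 1"] by simp_all
qed

context
  fixes s :: nat and K :: "nat \<Rightarrow> 'a::euclidean_space set"
  assumes config: "open_billiard_config s K"
begin

lemma obstacle:
  assumes "i \<in> {1..s}"
  shows "K i \<noteq> {}" "compact (K i)" "closed (K i)" "strictly_convex (K i)" "convex (K i)"
    "C2_boundary (K i)"
proof -
  have *: "K i \<noteq> {} \<and> compact (K i) \<and> strictly_convex (K i) \<and> C2_boundary (K i)"
    using config assms unfolding open_billiard_config_def by blast
  thus "K i \<noteq> {}" "compact (K i)" "strictly_convex (K i)" "C2_boundary (K i)" by simp_all
  thus "closed (K i)" "convex (K i)" by (simp_all add: compact_imp_closed strictly_convex_def)
qed

lemma obstacles_disjoint:
  "\<lbrakk>i \<in> {1..s}; j \<in> {1..s}; i \<noteq> j; p \<in> K i; q \<in> K j\<rbrakk> \<Longrightarrow> p \<noteq> q"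
  using config unfolding open_billiard_config_def by blast

text \<open>No-eclipse speaks of three distinct indices; when \<open>i = j\<close>, convexity keeps
  the segment inside \<open>K i\<close>.\<close>

lemma segment_avoids_obstacle:
  assumes "i \<in> {1..s}" "j \<in> {1..s}" "k \<in> {1..s}" "i \<noteq> k" "j \<noteq> k" "p \<in> K i" "q \<in> K j"
  shows "closed_segment p q \<inter> K k = {}"
proof (cases "i = j")
  case True
  hence "closed_segment p q \<subseteq> K i"
    using obstacle(5)[OF assms(1)] assms(6,7) by (simp add: closed_segment_subset)
  moreover have "K i \<inter> K k = {}" using config assms(1,3,4) unfolding open_billiard_config_def by blast
  ultimately show ?thesis by blast
next
  case False
  have "closed_segment p q \<subseteq> convex hull (K i \<union> K j)"
    using assms(6,7) by (intro closed_segment_subset convex_convex_hull) (auto intro: hull_inc)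
  moreover have "convex hull (K i \<union> K j) \<inter> K k = {}"
    using config assms(1-5) False unfolding open_billiard_config_def by simp
  ultimately show ?thesis by blast
qed

section \<open>Nondegeneracy and coercivity of the bend\<close>

text \<open>Zero bend would place \<open>q\<close> on the segment from \<open>p\<close> to
  \<open>r\<close>, which misses \<open>K j\<close>.\<close>

lemma bend_nonzero:
  assumes "i \<in> {1..s}" "j \<in> {1..s}" "k \<in> {1..s}" "i \<noteq> j" "k \<noteq> j" "p \<in> K i" "q \<in> K j" "r \<in> K k"
  shows "bend p q r \<noteq> 0"
  using sgn_eq_between[of q p r] segment_avoids_obstacle[of i k j p r] assms
    obstacles_disjoint[of j i q p] obstacles_disjoint[of j k q r] by auto

lemma continuous_bend:
  assumes "i \<in> {1..s}" "j \<in> {1..s}" "k \<in> {1..s}" "i \<noteq> j" "k \<noteq> j"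
    and "continuous_on A p" "continuous_on A q" "continuous_on A r"
    and "\<And>x. x \<in> A \<Longrightarrow> p x \<in> K i \<and> q x \<in> K j \<and> r x \<in> K k"
  shows "continuous_on A (\<lambda>x. bend (p x) (q x) (r x))"
proof -
  have "q x - p x \<noteq> 0" "q x - r x \<noteq> 0" if "x \<in> A" for x
    using that assms(9)[OF that] obstacles_disjoint[of j i "q x" "p x"]
      obstacles_disjoint[of j k "q x" "r x"] assms(1-5) by auto
  thus ?thesis unfolding bend_def by (intro continuous_intros assms ballI)
qed

text \<open>A compactness argument: strict convexity and a nonzero bend make the pairing positive on
  the compact set \<open>C\<close> of critical configurations with \<open>q'\<close> at distance at
  least \<epsilon> from \<open>q\<close>. Half its minimum there serves as \<delta>.\<close>

lemma bend_gap_coercive_triple: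
  assumes ijk: "i \<in> {1..s}" "j \<in> {1..s}" "k \<in> {1..s}" "i \<noteq> j" "k \<noteq> j" and "\<epsilon> > 0"
  shows "\<exists>\<delta>>0. \<forall>p\<in>K i. \<forall>q\<in>K j. \<forall>r\<in>K k. \<forall>q'\<in>K j.
    (\<forall>z\<in>K j. bend p q r \<bullet> (z - q) \<ge> 0) \<longrightarrow> bend p q r \<bullet> (q' - q) \<le> \<delta> \<longrightarrow> dist q q' < \<epsilon>"
proof -
  define A where "A = K i \<times> K j \<times> K k \<times> K j"
  define B where "B = (\<lambda>x::'a \<times> 'a \<times> 'a \<times> 'a. bend (fst x) (fst (snd x)) (fst (snd (snd x))))"
  define f where "f = (\<lambda>x. B x \<bullet> (snd (snd (snd x)) - fst (snd x)))"
  define C where "C = {x \<in> A. \<epsilon> \<le> dist (fst (snd x)) (snd (snd (snd x)))}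
    \<inter> (\<Inter>z\<in>K j. {x \<in> A. 0 \<le> B x \<bullet> (z - fst (snd x))})"
  have cA: "compact A" unfolding A_def using ijk by (intro compact_Times obstacle)
  have clA: "closed A" using cA by (rule compact_imp_closed)
  have cB: "continuous_on A B" unfolding B_def
    by (rule continuous_bend[OF ijk]) (auto simp: A_def intro!: continuous_intros)
  have "closed C" unfolding C_def
    by (intro closed_Int closed_INT ballI continuous_on_closed_Collect_le continuous_intros cB clA)
  moreover have "C \<subseteq> A" by (auto simp: C_def)
  ultimately have cC: "compact C" using cA closed_Int_compact[of C A] by (simp add: Int_absorb2)
  show ?thesis
  proof (cases "C = {}")
    case True
    have "dist q q' < \<epsilon>" if "p \<in> K i" "q \<in> K j" "r \<in> K k" "q' \<in> K j"
      "\<forall>z\<in>K j. bend p q r \<bullet> (z - q) \<ge> 0" for p q r q'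
    proof (rule ccontr)
      assume "\<not> ?thesis"
      hence "(p, q, r, q') \<in> C" using that by (auto simp: C_def A_def B_def)
      thus False using True by simp
    qed
    thus ?thesis by (intro exI[of _ 1]) auto
  next
    case False
    have "continuous_on C f" unfolding f_def
      by (intro continuous_intros continuous_on_subset[OF cB]) (auto simp: C_def)
    from continuous_attains_inf[OF cC False this]
    obtain x where x: "x \<in> C" "\<And>y. y \<in> C \<Longrightarrow> f x \<le> f y" by blast
    obtain p q r q' where x4: "x = (p, q, r, q')" by (rule prod_cases4)
    have mem: "p \<in> K i" "q \<in> K j" "r \<in> K k" "q' \<in> K j" "q \<noteq> q'"
      "\<And>z. z \<in> K j \<Longrightarrow> bend p q r \<bullet> (z - q) \<ge> 0"
      using x(1) \<open>\<epsilon> > 0\<close> by (auto simp: C_def x4 A_def B_def)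
    have "bend p q r \<bullet> (q' - q) > 0"
      using strictly_convex_critical_unique[OF obstacle(4)[OF ijk(2)] mem(2,4,5) _ mem(6)]
        bend_nonzero[OF ijk mem(1,2,3)] by blast
    hence pos: "f x > 0" by (simp add: f_def B_def x4)
    show ?thesis
    proof (intro exI[of _ "f x / 2"] conjI ballI impI)
      show "f x / 2 > 0" using pos by simp
      fix p q r q' assume *: "p \<in> K i" "q \<in> K j" "r \<in> K k" "q' \<in> K j"
        "\<forall>z\<in>K j. bend p q r \<bullet> (z - q) \<ge> 0" "bend p q r \<bullet> (q' - q) \<le> f x / 2"
      show "dist q q' < \<epsilon>"
      proof (rule ccontr)
        assume "\<not> ?thesis"
        hence "(p, q, r, q') \<in> C" using * by (auto simp: C_def A_def B_def)
        from x(2)[OF this] have "f x \<le> f x / 2" using *(6) by (simp add: f_def B_def)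
        thus False using pos by simp
      qed
    qed
  qed
qed

text \<open>There are finitely many triples of symbols, and a valid \<delta> may always be
  decreased; so the property holds eventually as \<delta> tends to 0 from the right, for all triples
  at once.\<close>

lemma bend_gap_coercive:
  assumes "\<epsilon> > 0"
  shows "\<exists>\<delta>>0. \<forall>i\<in>{1..s}. \<forall>j\<in>{1..s}. \<forall>k\<in>{1..s}. i \<noteq> j \<longrightarrow> k \<noteq> j \<longrightarrow>
    (\<forall>p\<in>K i. \<forall>q\<in>K j. \<forall>r\<in>K k. \<forall>q'\<in>K j.
    (\<forall>z\<in>K j. bend p q r \<bullet> (z - q) \<ge> 0) \<longrightarrow> bend p q r \<bullet> (q' - q) \<le> \<delta> \<longrightarrow> dist q q' < \<epsilon>)"
proof -
  let ?P = "\<lambda>i j k \<delta>. i \<noteq> j \<longrightarrow> k \<noteq> j \<longrightarrow> (\<forall>p\<in>K i. \<forall>q\<in>K j. \<forall>r\<in>K k. \<forall>q'\<in>K j.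
    (\<forall>z\<in>K j. bend p q r \<bullet> (z - q) \<ge> 0) \<longrightarrow> bend p q r \<bullet> (q' - q) \<le> \<delta> \<longrightarrow> dist q q' < \<epsilon>)"
  have "eventually (?P i j k) (at_right 0)"
    if ijk: "i \<in> {1..s}" "j \<in> {1..s}" "k \<in> {1..s}" for i j k
  proof (cases "i \<noteq> j \<and> k \<noteq> j")
    case True
    obtain d where d: "d > 0" "\<forall>p\<in>K i. \<forall>q\<in>K j. \<forall>r\<in>K k. \<forall>q'\<in>K j.
      (\<forall>z\<in>K j. bend p q r \<bullet> (z - q) \<ge> 0) \<longrightarrow> bend p q r \<bullet> (q' - q) \<le> d \<longrightarrow> dist q q' < \<epsilon>"
      using bend_gap_coercive_triple[OF ijk _ _ assms] True by blast
    show ?thesis unfolding eventually_at_right_field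
    proof (intro exI[of _ d] conjI allI impI ballI)
      fix e p q r q' assume *: "e < d" "p \<in> K i" "q \<in> K j" "r \<in> K k" "q' \<in> K j"
        "\<forall>z\<in>K j. bend p q r \<bullet> (z - q) \<ge> 0" "bend p q r \<bullet> (q' - q) \<le> e"
      have "bend p q r \<bullet> (q' - q) \<le> d" using * by linarith
      thus "dist q q' < \<epsilon>" using d(2) * by blast
    qed (rule d(1))
  qed auto
  hence "\<forall>\<^sub>F \<delta> in at_right 0. \<forall>i\<in>{1..s}. \<forall>j\<in>{1..s}. \<forall>k\<in>{1..s}. ?P i j k \<delta>"
    by (intro eventually_ball_finite ballI) auto
  then obtain d :: real where d: "d > 0"
    "\<And>e. 0 < e \<Longrightarrow> e < d \<Longrightarrow> \<forall>i\<in>{1..s}. \<forall>j\<in>{1..s}. \<forall>k\<in>{1..s}. ?P i j k e"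
    unfolding eventually_at_right_field by blast
  show ?thesis using d(2)[of "d / 2"] d(1) by (intro exI[of _ "d / 2"]) simp
qed


section \<open>Billiard orbits and critical orbits coincide\<close>

text \<open>By the reflection law the bend is \<nu> scaled by twice the incoming component along
  \<nu>. That component is nonpositive, and so is \<nu> paired with \<open>z - x i\<close>; the
  product is nonnegative.\<close>

lemma billiard_orbit_critical:
  assumes \<xi>: "\<xi> \<in> Sigma_sym s" and orb: "billiard_orbit s K \<xi> x"
  shows "critical_orbit (\<lambda>i. K (\<xi> i)) x"
  unfolding critical_orbit_def critical_at_def
proof (intro allI conjI ballI)
  fix i
  have fr: "x i \<in> frontier (K (\<xi> i))" for i using orb unfolding billiard_orbit_def by blast
  show mem: "x i \<in> K (\<xi> i)"
    using fr[of i] frontier_subset_closed[OF obstacle(3)[OF Sigma_symD(1)[OF \<xi>]]] by blast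
  fix z assume z: "z \<in> K (\<xi> i)"
  obtain \<nu> where \<nu>: "outer_normal (K (\<xi> i)) (x i) \<nu>"
    and refl: "sgn (x (i + 1) - x i)
      = sgn (x i - x (i - 1)) - (2 * (sgn (x i - x (i - 1)) \<bullet> \<nu>)) *\<^sub>R \<nu>"
    using orb unfolding billiard_orbit_def by blast
  have seg: "open_segment (x (i - 1)) (x i) \<inter> K (\<xi> i) = {}" and ne: "x (i - 1) \<noteq> x i"
  proof -
    have "open_segment (x (i - 1)) (x (i - 1 + 1)) \<inter> (\<Union>j\<in>{1..s}. K j) = {}"
      "x (i - 1) \<noteq> x (i - 1 + 1)"
      using orb unfolding billiard_orbit_def by blast+
    thus "open_segment (x (i - 1)) (x i) \<inter> K (\<xi> i) = {}" "x (i - 1) \<noteq> x i"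
      using Sigma_symD(1)[OF \<xi>, of i] unfolding diff_add_cancel by blast+
  qed
  have "\<nu> \<bullet> (x i - x (i - 1)) \<le> 0"
  proof (rule outer_normal_incoming[OF obstacle(6)[OF Sigma_symD(1)[OF \<xi>]] fr mem \<nu>])
    fix t :: real assume t: "0 < t" "t < 1"
    have "x i - t *\<^sub>R (x i - x (i - 1)) \<in> open_segment (x (i - 1)) (x i)"
      using t ne unfolding in_segment
      by (intro conjI exI[of _ "1 - t"]) (auto simp: algebra_simps)
    thus "x i - t *\<^sub>R (x i - x (i - 1)) \<notin> K (\<xi> i)" using seg by blast
  qed
  hence "sgn (x i - x (i - 1)) \<bullet> \<nu> \<le> 0"
    by (simp add: sgn_div_norm inner_commute divide_nonpos_nonneg mult_nonneg_nonpos)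
  moreover have "\<nu> \<bullet> (z - x i) \<le> 0" using \<nu> z unfolding outer_normal_def by blast
  moreover have "bend (x (i - 1)) (x i) (x (i + 1)) = (2 * (sgn (x i - x (i - 1)) \<bullet> \<nu>)) *\<^sub>R \<nu>"
    using refl by (simp add: bend_alt)
  ultimately show "0 \<le> bend (x (i - 1)) (x i) (x (i + 1)) \<bullet> (z - x i)"
    by (simp add: mult_nonpos_nonpos)
qed

text \<open>The nonzero bend \<open>w i\<close> is an inner normal at \<open>x i\<close> and equals
  the difference of the incoming and outgoing directions, which is the reflection law. Its sign
  along the edges also keeps them out of the obstacles at their ends.\<close>

lemma critical_orbit_billiard:
  assumes \<xi>: "\<xi> \<in> Sigma_sym s" and crit: "critical_orbit (\<lambda>i. K (\<xi> i)) x"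
  shows "billiard_orbit s K \<xi> x"
proof -
  note sym = Sigma_symD[OF \<xi>]
  define w where "w i = bend (x (i - 1)) (x i) (x (i + 1))" for i
  define u where "u i = sgn (x (i + 1) - x i)" for i
  have mem: "x i \<in> K (\<xi> i)" for i using crit unfolding critical_orbit_def by blast
  have vi: "w i \<bullet> (z - x i) \<ge> 0" if "z \<in> K (\<xi> i)" for i z
    using crit that unfolding critical_orbit_def critical_at_def w_def by blast
  have ne: "x i \<noteq> x (i + 1)" for i
    using obstacles_disjoint[OF sym(1) sym(1) sym(2) mem mem] .
  have w0: "w i \<noteq> 0" for i
    unfolding w_def using bend_nonzero[OF sym(1) sym(1) sym(1) sym(4) sym(3) mem mem mem] .
  have wu: "w i = u (i - 1) - u i" for i by (simp add: w_def u_def bend_alt)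
  have u1: "norm (u i) = 1" for i unfolding u_def using ne[of i] by (intro norm_sgn_1) simp
  have wneg: "w i \<bullet> u i < 0" "w i \<bullet> u (i - 1) > 0" for i
  proof -
    have "(norm (w i))\<^sup>2 > 0" using w0[of i] by simp
    thus "w i \<bullet> u i < 0" "w i \<bullet> u (i - 1) > 0"
      using unit_diff_inner[OF u1[of "i - 1"] u1[of i]] unfolding wu by linarith+
  qed
  have scale: "x (i + 1) - x i = norm (x (i + 1) - x i) *\<^sub>R u i" for i
    using ne[of i] by (simp add: u_def sgn_div_norm)
  have len: "norm (x (i + 1) - x i) > 0" for i using ne[of i] by simp
  \<comment> \<open>An edge leaves \<open>x i\<close> strictly against \<open>w i\<close> and
    reaches \<open>x (i + 1)\<close> strictly along \<open>w (i + 1)\<close>.\<close>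
  have wneg1: "w i \<bullet> (x (i + 1) - x i) < 0" for i
    using wneg(1)[of i] len[of i] by (subst scale) (simp add: mult_pos_neg)
  have wneg2: "w (i + 1) \<bullet> (x (i + 1) - x i) > 0" for i
    using wneg(2)[of "i + 1"] len[of i] by (subst scale) simp
  show ?thesis unfolding billiard_orbit_def
  proof (intro conjI allI ne)
    fix i
    have "x i \<notin> interior (K (\<xi> i))"
    proof
      assume "x i \<in> interior (K (\<xi> i))"
      then obtain e where e: "e > 0" "cball (x i) e \<subseteq> K (\<xi> i)" by (metis mem_interior_cball)
      \<comment> \<open>At an interior point a step against the bend would stay in the obstacle and
        violate \<open>vi\<close>.\<close>
      have "x i - (e / norm (w i)) *\<^sub>R w i \<in> K (\<xi> i)"
        using e w0[of i] by (intro subsetD[OF e(2)]) (simp add: dist_norm)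
      from vi[OF this] have "e / norm (w i) * (w i \<bullet> w i) \<le> 0" by simp
      moreover have "e / norm (w i) * (w i \<bullet> w i) > 0" using e w0[of i] by simp
      ultimately show False by linarith
    qed
    thus "x i \<in> frontier (K (\<xi> i))" using mem[of i] closure_subset by (auto simp: frontier_def)
    show "open_segment (x i) (x (i + 1)) \<inter> (\<Union>j\<in>{1..s}. K j) = {}"
    proof (rule ccontr)
      assume "\<not> ?thesis"
      then obtain y j where y: "y \<in> open_segment (x i) (x (i + 1))" "j \<in> {1..s}" "y \<in> K j" by blast
      then obtain t where t: "0 < t" "t < 1" "y = (1 - t) *\<^sub>R x i + t *\<^sub>R x (i + 1)"
        by (auto simp: in_segment)
      \<comment> \<open>No-eclipse excludes all other obstacles; for these two, \<open>y\<close>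
        would violate the variational inequality at one end of the edge.\<close>
      have "j = \<xi> i \<or> j = \<xi> (i + 1)"
        using segment_avoids_obstacle[OF sym(1) sym(1) y(2) _ _ mem mem, of i "i + 1"] y(1,3)
          open_closed_segment by blast
      thus False
      proof
        assume j: "j = \<xi> i"
        have "y - x i = t *\<^sub>R (x (i + 1) - x i)" by (simp add: t algebra_simps)
        hence "w i \<bullet> (y - x i) < 0" using wneg1[of i] t by (simp add: mult_pos_neg)
        thus False using vi[of y i] y(3) j by simp
      next
        assume j: "j = \<xi> (i + 1)"
        have "y - x (i + 1) = - ((1 - t) *\<^sub>R (x (i + 1) - x i))" by (simp add: t algebra_simps)
        hence "w (i + 1) \<bullet> (y - x (i + 1)) < 0" using wneg2[of i] t by simp
        thus False using vi[of y "i + 1"] y(3) j by simp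
      qed
    qed
    define \<nu> where "\<nu> = - sgn (w i)"
    have "outer_normal (K (\<xi> i)) (x i) \<nu>"
      unfolding outer_normal_def using vi[of _ i] w0[of i]
      by (auto simp: \<nu>_def norm_sgn) (simp add: sgn_div_norm)
    moreover have "(2 * (u (i - 1) \<bullet> \<nu>)) *\<^sub>R \<nu> = w i"
    proof -
      have "u (i - 1) \<bullet> w i = (norm (w i))\<^sup>2 / 2"
        using unit_diff_inner(1)[OF u1[of "i - 1"] u1[of i]] by (simp add: wu inner_commute)
      hence "u (i - 1) \<bullet> sgn (w i) = norm (w i) / 2"
        using w0[of i] by (simp add: sgn_div_norm field_simps power2_eq_square)
      hence "(2 * (u (i - 1) \<bullet> \<nu>)) *\<^sub>R \<nu> = norm (w i) *\<^sub>R sgn (w i)" by (simp add: \<nu>_def)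
      thus ?thesis using w0[of i] by (simp add: sgn_div_norm)
    qed
    ultimately show "\<exists>\<nu>. outer_normal (K (\<xi> i)) (x i) \<nu> \<and> sgn (x (i + 1) - x i)
      = sgn (x i - x (i - 1)) - (2 * (sgn (x i - x (i - 1)) \<bullet> \<nu>)) *\<^sub>R \<nu>"
      using wu[of i] by (intro exI[of _ \<nu>]) (simp add: u_def algebra_simps)
  qed
qed


subsection \<open>Existence and stability of critical orbits\<close>

lemma obstacles_bounded: "\<exists>M>0. \<forall>i\<in>{1..s}. \<forall>p\<in>K i. norm p \<le> M"
proof -
  have "bounded (\<Union>i\<in>{1..s}. K i)"
    using obstacle(2) by (intro bounded_UN ballI compact_imp_bounded) auto
  thus ?thesis unfolding bounded_pos by auto
qed

text \<open>Summation by parts is used twice: over windows of fixed length with a crude boundary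
  bound, to find good indices on both sides of 0, and then between those indices. The radius
  \<open>m\<close> depends on \<epsilon> only, not on the itineraries.\<close>

lemma critical_orbit_stable:
  assumes "\<epsilon> > 0"
  shows "\<exists>m::nat. \<forall>\<xi>\<in>Sigma_sym s. \<forall>\<eta>\<in>Sigma_sym s. \<forall>x y.
    critical_orbit (\<lambda>i. K (\<xi> i)) x \<longrightarrow> critical_orbit (\<lambda>i. K (\<eta> i)) y \<longrightarrow>
    (\<forall>i. \<bar>i\<bar> \<le> int m \<longrightarrow> \<xi> i = \<eta> i) \<longrightarrow> dist (x 0) (y 0) < \<epsilon>"
proof -
  obtain M where M: "M > 0" "\<And>i p. i \<in> {1..s} \<Longrightarrow> p \<in> K i \<Longrightarrow> norm p \<le> M"
    using obstacles_bounded by blast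
  \<comment> \<open>A gap of at most \<delta> at 0 gives the claim. The tolerance \<delta>1 makes
    displacements less than \<open>\<delta> / 4\<close>, so that two boundary terms, each with
    factor 2, add up to at most \<delta>.\<close>
  obtain \<delta> where \<delta>: "\<delta> > 0" and \<delta>': "\<And>i j k p q r q'. \<lbrakk>i \<in> {1..s}; j \<in> {1..s}; k \<in> {1..s};
      i \<noteq> j; k \<noteq> j; p \<in> K i; q \<in> K j; r \<in> K k; q' \<in> K j; \<forall>z\<in>K j. bend p q r \<bullet> (z - q) \<ge> 0;
      bend p q r \<bullet> (q' - q) \<le> \<delta>\<rbrakk> \<Longrightarrow> dist q q' < \<epsilon>"
    using bend_gap_coercive[OF assms] by metis
  obtain \<delta>1 where \<delta>1: "\<delta>1 > 0" and \<delta>1': "\<And>i j k p q r q'. \<lbrakk>i \<in> {1..s}; j \<in> {1..s}; k \<in> {1..s};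
      i \<noteq> j; k \<noteq> j; p \<in> K i; q \<in> K j; r \<in> K k; q' \<in> K j; \<forall>z\<in>K j. bend p q r \<bullet> (z - q) \<ge> 0;
      bend p q r \<bullet> (q' - q) \<le> \<delta>1\<rbrakk> \<Longrightarrow> dist q q' < \<delta> / 4"
    using bend_gap_coercive[of "\<delta> / 4"] \<delta> by (metis zero_less_divide_iff zero_less_numeral)
  \<comment> \<open>Displacements are at most \<open>2 * M\<close>, so the two boundary terms of any
    window total at most \<open>8 * M\<close>.\<close>
  obtain n where n: "real n * \<delta>1 > 8 * M"
    using reals_Archimedean3[OF \<delta>1] by blast
  have "dist (x 0) (y 0) < \<epsilon>"
    if \<xi>: "\<xi> \<in> Sigma_sym s" and \<eta>: "\<eta> \<in> Sigma_sym s"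
      and x: "critical_orbit (\<lambda>i. K (\<xi> i)) x" and y: "critical_orbit (\<lambda>i. K (\<eta> i)) y"
      and agree: "\<And>i. \<bar>i\<bar> \<le> int (Suc n) \<Longrightarrow> \<xi> i = \<eta> i" for \<xi> \<eta> x y
  proof -
    define c where "c i = bend_gap x y i + bend_gap y x i" for i
    have mem: "x i \<in> K (\<xi> i)" "y i \<in> K (\<eta> i)" for i
      using x y unfolding critical_orbit_def by blast+
    have vi: "\<forall>z\<in>K (\<xi> i). bend (x (i - 1)) (x i) (x (i + 1)) \<bullet> (z - x i) \<ge> 0"
      "\<forall>z\<in>K (\<eta> i). bend (y (i - 1)) (y i) (y (i + 1)) \<bullet> (z - y i) \<ge> 0" for i
      using x y unfolding critical_orbit_def critical_at_def by blast+
    \<comment> \<open>Agreement of the symbols puts \<open>x i\<close> and \<open>y i\<close> in the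
      same obstacle, so each is an admissible test point for the other.\<close>
    have gap_nonneg: "bend_gap x y i \<ge> 0" "bend_gap y x i \<ge> 0" if "\<bar>i\<bar> \<le> int (Suc n)" for i
      using vi[of i] mem[of i] agree[OF that] unfolding bend_gap_def by auto
    have gap_dist: "dist (x i) (y i) < \<epsilon>" if "\<bar>i\<bar> \<le> int (Suc n)" "c i \<le> \<delta>" for i
      using \<delta>'[OF Sigma_symD(1)[OF \<xi>] Sigma_symD(1)[OF \<xi>] Sigma_symD(1)[OF \<xi>]
          Sigma_symD(4)[OF \<xi>] Sigma_symD(3)[OF \<xi>] mem(1) mem(1) mem(1) _ vi(1), of "y i" i]
        mem(2)[of i] agree[OF that(1)] that(2) gap_nonneg(2)[OF that(1)]
      by (simp add: c_def bend_gap_def)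
    have gap_dist1: "dist (x i) (y i) < \<delta> / 4" if "\<bar>i\<bar> \<le> int (Suc n)" "c i \<le> \<delta>1" for i
      using \<delta>1'[OF Sigma_symD(1)[OF \<xi>] Sigma_symD(1)[OF \<xi>] Sigma_symD(1)[OF \<xi>]
          Sigma_symD(4)[OF \<xi>] Sigma_symD(3)[OF \<xi>] mem(1) mem(1) mem(1) _ vi(1), of "y i" i]
        mem(2)[of i] agree[OF that(1)] that(2) gap_nonneg(2)[OF that(1)]
      by (simp add: c_def bend_gap_def)
    have c0: "c i \<ge> 0" if "\<bar>i\<bar> \<le> int (Suc n)" for i
      using gap_nonneg[OF that] by (simp add: c_def)
    have d2M: "norm (y i - x i) \<le> 2 * M" for i
      using norm_triangle_ineq4[of "y i" "x i"] M(2)[OF Sigma_symD(1)[OF \<xi>] mem(1), of i]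
        M(2)[OF Sigma_symD(1)[OF \<eta>] mem(2), of i] by linarith
    have pigeonhole: "\<exists>k\<in>{1..n}. c (j + int k) \<le> \<delta>1" for j
    proof (rule ccontr)
      assume "\<not> ?thesis"
      hence "(\<Sum>k\<in>{1..n}. \<delta>1) \<le> (\<Sum>k\<in>{1..n}. c (j + int k))"
        by (intro sum_mono) (auto simp: not_le intro: less_imp_le)
      also have "\<dots> \<le> 8 * M"
        using sum_bend_gap_le[of x y j n] d2M[of j] d2M[of "j + int n + 1"]
        unfolding c_def by linarith
      finally show False using n by simp
    qed
    obtain k1 where k1: "k1 \<in> {1..n}" "c (int k1) \<le> \<delta>1" using pigeonhole[of 0] by auto
    \<comment> \<open>This window consists of the indices from \<open>- n\<close> to
      \<open>-1\<close>, so the index found is strictly negative.\<close>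
    obtain k2 where k2: "k2 \<in> {1..n}" "c (- int (Suc n) + int k2) \<le> \<delta>1" using pigeonhole by blast
    define j where "j = - int (Suc n) + int k2"
    \<comment> \<open>The indices strictly between \<open>j\<close> and \<open>k1\<close> are
      \<open>j + 1\<close> to \<open>j + l\<close>, and 0 is among them.\<close>
    define l where "l = nat (int k1 - j - 1)"
    have j: "j < 0" "\<bar>j\<bar> \<le> int (Suc n)" "j + int l + 1 = int k1"
      using k1 k2 by (auto simp: j_def l_def)
    have "c 0 = (\<Sum>k\<in>{nat (- j)}. c (j + int k))" using j(1) by simp
    also have "\<dots> \<le> (\<Sum>k\<in>{1..l}. c (j + int k))"
    proof (intro sum_mono2 c0)
      show "{nat (- j)} \<subseteq> {1..l}" using j k1(1) by auto
    qed (use j k1(1) in auto)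
    also have "\<dots> \<le> 2 * norm (y j - x j) + 2 * norm (y (int k1) - x (int k1))"
      using sum_bend_gap_le[of x y j l] unfolding c_def j(3) .
    also have "\<dots> \<le> \<delta>"
      using gap_dist1[OF j(2)] gap_dist1[of "int k1"] k1 k2(2)
      by (simp add: j_def dist_norm norm_minus_commute)
    finally show ?thesis using gap_dist[of 0] by simp
  qed
  thus ?thesis by (intro exI[of _ "Suc n"]) blast
qed

text \<open>A bi-infinite path has no total length to minimise. Minimisers of finite partial lengths
  are critical at any prescribed finite set of indices, and compactness of the product supplies one
  path critical everywhere.\<close>

lemma critical_orbit_exists:
  assumes \<xi>: "\<xi> \<in> Sigma_sym s"
  shows "\<exists>x. critical_orbit (\<lambda>i. K (\<xi> i)) x"
proof -
  define S where "S i = K (\<xi> i)" for i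
  note sym = Sigma_symD[OF \<xi>]
  have S: "convex (S i)" "compact (S i)" "closed (S i)" "S i \<noteq> {}" for i
    using obstacle[OF sym(1)] by (simp_all add: S_def)
  have disj: "S i \<inter> S (i + 1) = {}" for i
    using obstacles_disjoint[OF sym(1) sym(1) sym(2)] unfolding S_def by blast
  define P where "P = {x. \<forall>i. x i \<in> S i}"
  have P: "P = PiE UNIV S" by (auto simp: P_def)
  \<comment> \<open>Tychonoff's theorem, stated for abstract topologies and then transferred to the
    function type.\<close>
  have "compactin (product_topology (\<lambda>i. euclidean) UNIV) (PiE UNIV S)"
    using S(2) by (subst compactin_PiE) auto
  hence cP: "compact P" unfolding P euclidean_product_topology by simp
  have P0: "P \<noteq> {}" unfolding P PiE_eq_empty_iff using S(4) by blast
  have coord: "continuous_on P (\<lambda>x. x i)" for i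
    by (rule continuous_on_subset[OF continuous_on_product_coordinates]) simp
  have clE: "closed {x\<in>P. critical_at S x i}" for i
  proof -
    have "continuous_on P (\<lambda>x. bend (x (i - 1)) (x i) (x (i + 1)))"
      by (rule continuous_bend[OF sym(1) sym(1) sym(1) sym(4) sym(3) coord coord coord])
        (auto simp: P_def S_def)
    hence "closed (P \<inter> (\<Inter>z\<in>S i. {x\<in>P. 0 \<le> bend (x (i - 1)) (x i) (x (i + 1)) \<bullet> (z - x i)}))"
      by (intro closed_Int closed_INT ballI continuous_on_closed_Collect_le continuous_intros coord
          compact_imp_closed[OF cP])
    also have "P \<inter> (\<Inter>z\<in>S i. {x\<in>P. 0 \<le> bend (x (i - 1)) (x i) (x (i + 1)) \<bullet> (z - x i)})
      = {x\<in>P. critical_at S x i}"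
      by (auto simp: critical_at_def)
    finally show ?thesis .
  qed
  have "P \<inter> (\<Inter>i\<in>UNIV. {x\<in>P. critical_at S x i}) \<noteq> {}"
  proof (rule compact_imp_fip_image[OF cP clE])
    fix I :: "int set" assume I: "finite I"
    \<comment> \<open>Both edges adjacent to each vertex in \<open>I\<close> have to be
      counted.\<close>
    define J where "J = I \<union> (\<lambda>i. i - 1) ` I"
    have "continuous_on P (\<lambda>x. \<Sum>i\<in>J. norm (x (i + 1) - x i))"
      by (intro continuous_intros coord)
    from continuous_attains_inf[OF cP P0 this]
    obtain x where x: "x \<in> P" "\<And>y. y \<in> P \<Longrightarrow>
      (\<Sum>i\<in>J. norm (x (i + 1) - x i)) \<le> (\<Sum>i\<in>J. norm (y (i + 1) - y i))" by blast
    have "critical_at S x i" if "i \<in> I" for i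
    proof (rule length_minimizer_critical[where S = S and x = x and I = J, OF S(1) disj])
      show "x i \<in> S i" for i using x(1) by (simp add: P_def)
      show "(\<Sum>i\<in>J. norm (x (i + 1) - x i)) \<le> (\<Sum>i\<in>J. norm (y (i + 1) - y i))"
        if "\<And>i. y i \<in> S i" for y using x(2) that by (simp add: P_def)
    qed (use I that in \<open>auto simp: J_def\<close>)
    thus "P \<inter> (\<Inter>i\<in>I. {x\<in>P. critical_at S x i}) \<noteq> {}" using x(1) by blast
  qed
  then obtain x where "x \<in> P" "\<forall>i. critical_at S x i" by blast
  thus ?thesis unfolding critical_orbit_def P_def S_def[abs_def] by blast
qed

section \<open>The observable and its uniform continuity\<close>

lemma phi_billiard_eq:
  assumes \<xi>: "\<xi> \<in> Sigma_sym s" and x: "critical_orbit (\<lambda>i. K (\<xi> i)) x"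
  shows "phi_billiard s K \<xi> = x 0"
  unfolding phi_billiard_def
proof (rule the_equality)
  show "\<exists>x'. billiard_orbit s K \<xi> x' \<and> x' 0 = x 0"
    using critical_orbit_billiard[OF assms] by blast
  fix q assume "\<exists>x. billiard_orbit s K \<xi> x \<and> x 0 = q"
  then obtain y where y: "critical_orbit (\<lambda>i. K (\<xi> i)) y" "y 0 = q"
    using billiard_orbit_critical[OF \<xi>] by blast
  \<comment> \<open>Uniqueness is stability applied with both itineraries equal to \<xi>, which
    agree on every window.\<close>
  have "dist (y 0) (x 0) \<le> \<epsilon>" if "\<epsilon> > 0" for \<epsilon>
    using critical_orbit_stable[OF that] \<xi> x y(1) less_imp_le by blast
  hence "dist (y 0) (x 0) \<le> 0" by (rule field_le_epsilon) simp
  thus "q = x 0" using y(2) by simp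
qed

lemma phi_billiard_mem:
  assumes "\<xi> \<in> Sigma_sym s"
  shows "phi_billiard s K \<xi> \<in> K (\<xi> 0)"
proof -
  obtain x where x: "critical_orbit (\<lambda>i. K (\<xi> i)) x" using critical_orbit_exists[OF assms] ..
  show ?thesis using phi_billiard_eq[OF assms x] x unfolding critical_orbit_def by simp
qed

text \<open>Together with boundedness, this is all that the averaging argument uses about the
  billiard.\<close>

lemma phi_billiard_uniform:
  assumes "\<epsilon> > 0"
  shows "\<exists>m::nat. \<forall>\<xi>\<in>Sigma_sym s. \<forall>\<eta>\<in>Sigma_sym s. (\<forall>i. \<bar>i\<bar> \<le> int m \<longrightarrow> \<xi> i = \<eta> i) \<longrightarrow>
    dist (phi_billiard s K \<xi>) (phi_billiard s K \<eta>) < \<epsilon>"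
proof -
  obtain m :: nat where m: "\<And>\<xi> \<eta> x y. \<lbrakk>\<xi> \<in> Sigma_sym s; \<eta> \<in> Sigma_sym s;
      critical_orbit (\<lambda>i. K (\<xi> i)) x; critical_orbit (\<lambda>i. K (\<eta> i)) y;
      \<forall>i. \<bar>i\<bar> \<le> int m \<longrightarrow> \<xi> i = \<eta> i\<rbrakk> \<Longrightarrow> dist (x 0) (y 0) < \<epsilon>"
    using critical_orbit_stable[OF assms] by blast
  show ?thesis
  proof (intro exI[of _ m] ballI impI)
    fix \<xi> \<eta> assume *: "\<xi> \<in> Sigma_sym s" "\<eta> \<in> Sigma_sym s" "\<forall>i. \<bar>i\<bar> \<le> int m \<longrightarrow> \<xi> i = \<eta> i"
    obtain x where x: "critical_orbit (\<lambda>i. K (\<xi> i)) x" using critical_orbit_exists[OF *(1)] ..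
    obtain y where y: "critical_orbit (\<lambda>i. K (\<eta> i)) y" using critical_orbit_exists[OF *(2)] ..
    show "dist (phi_billiard s K \<xi>) (phi_billiard s K \<eta>) < \<epsilon>"
      unfolding phi_billiard_eq[OF *(1) x] phi_billiard_eq[OF *(2) y] using m[OF *(1,2) x y *(3)] .
  qed
qed

end

subsection \<open>Averages along symbol sequences\<close>

lemma shift_funpow: "(shift ^^ n) \<xi> = (\<lambda>j. \<xi> (j + int n))"
  by (induction n) (simp_all add: shift_def algebra_simps)

lemma shift_funpow_Sigma: "\<xi> \<in> Sigma_sym s \<Longrightarrow> (shift ^^ n) \<xi> \<in> Sigma_sym s"
proof -
  assume "\<xi> \<in> Sigma_sym s"
  hence "\<xi> i \<in> {1..s}" "\<xi> (i + int n) \<noteq> \<xi> (i + int n + 1)" for i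
    unfolding Sigma_sym_def by blast+
  moreover have "i + int n + 1 = i + 1 + int n" for i by simp
  ultimately show ?thesis unfolding Sigma_sym_def shift_funpow by simp
qed

lemma sum_lessThan_append: "(\<Sum>i<a + b. g i) = (\<Sum>i<a. g i) + (\<Sum>i<b. g (a + i))"
  for g :: "nat \<Rightarrow> 'b::comm_monoid_add"
  by (induction b) (simp_all add: ac_simps)

text \<open>The centred partial sums \<open>H\<close> vanish at \<open>p\<close>, hence are periodic
  and bounded, so dividing by \<open>n\<close> sends them to 0.\<close>

lemma periodic_average_tendsto:
  fixes g :: "nat \<Rightarrow> 'a::real_normed_vector"
  assumes per: "\<And>i. g (i + p) = g i" and "p > 0"
  shows "(\<lambda>n. (1 / real n) *\<^sub>R (\<Sum>i<n. g i)) \<longlonglongrightarrow> (1 / real p) *\<^sub>R (\<Sum>i<p. g i)"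
proof -
  define \<mu> where "\<mu> = (1 / real p) *\<^sub>R (\<Sum>i<p. g i)"
  define H where "H n = (\<Sum>i<n. g i - \<mu>)" for n
  have H: "H n = (\<Sum>i<n. g i) - real n *\<^sub>R \<mu>" for n
    by (simp add: H_def sum_subtractf sum_constant_scaleR)
  have "H p = 0" using \<open>p > 0\<close> by (simp add: H \<mu>_def)
  hence Hper: "H (p + n) = H n" for n
    unfolding H_def sum_lessThan_append using per by (simp add: add.commute)
  define B where "B = (\<Sum>k<p. norm (H k))"
  have bnd: "norm (H n) \<le> B" for n
  proof (induction n rule: less_induct)
    case (less n)
    show ?case
    proof (cases "n < p")
      case True
      thus ?thesis unfolding B_def by (intro member_le_sum) auto
    next
      case False
      thus ?thesis using less[of "n - p"] Hper[of "n - p"] \<open>p > 0\<close> by simp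
    qed
  qed
  have "((\<lambda>n. (1 / real n) *\<^sub>R H n) \<longlongrightarrow> 0) sequentially"
  proof (rule Lim_null_comparison)
    show "\<forall>\<^sub>F n in sequentially. norm ((1 / real n) *\<^sub>R H n) \<le> B * (1 / real n)"
      using bnd by (intro always_eventually allI) (simp add: divide_right_mono)
    show "(\<lambda>n. B * (1 / real n)) \<longlonglongrightarrow> 0"
      using tendsto_mult_right_zero[OF lim_1_over_n] by simp
  qed
  hence lim: "(\<lambda>n. (1 / real n) *\<^sub>R H n + \<mu>) \<longlonglongrightarrow> 0 + \<mu>" by (intro tendsto_intros)
  \<comment> \<open>At \<open>n = 0\<close> division by zero yields 0 and the left side is \<mu>, so
    the identity is claimed only for \<open>n > 0\<close>.\<close>
  have "\<forall>\<^sub>F n in sequentially. (1 / real n) *\<^sub>R H n + \<mu> = (1 / real n) *\<^sub>R (\<Sum>i<n. g i)"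
    using eventually_gt_at_top[of 0] by eventually_elim (simp add: H scaleR_diff_right)
  from Lim_transform_eventually[OF lim this] show ?thesis by (simp add: \<mu>_def)
qed

text \<open>A time at distance at least \<open>m\<close> from both ends of the block sees agreeing
  windows and costs at most \<epsilon>. At most \<open>2 * m\<close> times remain, each costing at
  most \<open>2 * M\<close>.\<close>

lemma orbit_sum_block_le:
  fixes f :: "(int \<Rightarrow> nat) \<Rightarrow> 'a::real_normed_vector"
  assumes bound: "\<And>\<xi>. \<xi> \<in> Sigma_sym s \<Longrightarrow> norm (f \<xi>) \<le> M" and "\<epsilon> \<ge> 0"
    and unif: "\<And>\<xi> \<eta>. \<lbrakk>\<xi> \<in> Sigma_sym s; \<eta> \<in> Sigma_sym s; \<And>i. \<bar>i\<bar> \<le> int m \<Longrightarrow> \<xi> i = \<eta> i\<rbrakk>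
      \<Longrightarrow> dist (f \<xi>) (f \<eta>) \<le> \<epsilon>"
    and \<xi>: "\<xi> \<in> Sigma_sym s" and \<zeta>: "\<zeta> \<in> Sigma_sym s"
    and agree: "\<And>i. 0 \<le> i \<Longrightarrow> i < int n \<Longrightarrow> \<zeta> (int a + i) = \<xi> i"
  shows "norm ((\<Sum>i<n. f ((shift ^^ (a + i)) \<zeta>)) - (\<Sum>i<n. f ((shift ^^ i) \<xi>)))
    \<le> real n * \<epsilon> + 4 * real m * M"
proof -
  \<comment> \<open>If \<open>n < m\<close>, truncated subtraction makes \<open>B\<close> contain
    the whole block.\<close>
  define B where "B = {..<m} \<union> {n - m..<n}"
  have M: "M \<ge> 0" using bound[OF \<xi>] norm_ge_zero[of "f \<xi>"] by linarith
  have le: "norm (f ((shift ^^ (a + i)) \<zeta>) - f ((shift ^^ i) \<xi>)) \<le> \<epsilon> + (if i \<in> B then 2 * M else 0)"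
    if i: "i < n" for i
  proof (cases "i \<in> B")
    case True
    have "norm (f ((shift ^^ (a + i)) \<zeta>) - f ((shift ^^ i) \<xi>)) \<le> M + M"
      by (intro norm_triangle_le_diff add_mono bound shift_funpow_Sigma \<xi> \<zeta>)
    thus ?thesis using True \<open>\<epsilon> \<ge> 0\<close> by simp
  next
    case False
    have "dist (f ((shift ^^ (a + i)) \<zeta>)) (f ((shift ^^ i) \<xi>)) \<le> \<epsilon>"
    proof (intro unif shift_funpow_Sigma \<xi> \<zeta>)
      fix k :: int assume "\<bar>k\<bar> \<le> int m"
      thus "(shift ^^ (a + i)) \<zeta> k = (shift ^^ i) \<xi> k"
        using agree[of "k + int i"] False i by (auto simp: B_def shift_funpow algebra_simps)
    qed
    thus ?thesis using False by (simp add: dist_norm)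
  qed
  have "card ({..<n} \<inter> B) \<le> card B" by (intro card_mono) (auto simp: B_def)
  also have "\<dots> \<le> m + m" unfolding B_def by (rule order_trans[OF card_Un_le]) simp
  finally have card: "real (card ({..<n} \<inter> B)) \<le> 2 * real m" by linarith
  have "norm ((\<Sum>i<n. f ((shift ^^ (a + i)) \<zeta>)) - (\<Sum>i<n. f ((shift ^^ i) \<xi>)))
    \<le> (\<Sum>i<n. \<epsilon> + (if i \<in> B then 2 * M else 0))"
    unfolding sum_subtractf[symmetric] by (rule sum_norm_le) (use le in auto)
  also have "\<dots> = real n * \<epsilon> + real (card ({..<n} \<inter> B)) * (2 * M)"
    by (simp add: sum.distrib sum.If_cases)
  also have "\<dots> \<le> real n * \<epsilon> + 2 * real m * (2 * M)"
    using card M by (intro add_left_mono mult_right_mono) auto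
  finally show ?thesis by simp
qed

text \<open>With at least three symbols, any two blocks can be joined through a single extra symbol.\<close>

lemma periodic_concatenation:
  assumes s: "s \<ge> 3" and \<xi>: "\<xi> \<in> Sigma_sym s" and \<eta>: "\<eta> \<in> Sigma_sym s" and n: "n > 0"
  obtains \<zeta> where "\<zeta> \<in> Sigma_sym s" "(shift ^^ (2 * n + 2)) \<zeta> = \<zeta>"
    "\<And>i. 0 \<le> i \<Longrightarrow> i < int n \<Longrightarrow> \<zeta> i = \<xi> i"
    "\<And>i. 0 \<le> i \<Longrightarrow> i < int n \<Longrightarrow> \<zeta> (int n + 1 + i) = \<eta> i"
proof -
  have third: "\<exists>c\<in>{1..s}. c \<noteq> a \<and> c \<noteq> b" for a b
  proof (rule ccontr)
    assume "\<not> ?thesis"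
    hence "{1..s} \<subseteq> {a, b}" by blast
    hence "card {1..s} \<le> card {a, b}" by (intro card_mono) auto
    also have "\<dots> \<le> 2" by (simp add: card_insert_if)
    finally show False using s by simp
  qed
  obtain c where c: "c \<in> {1..s}" "c \<noteq> \<xi> (int n - 1)" "c \<noteq> \<eta> 0" using third by blast
  obtain d where d: "d \<in> {1..s}" "d \<noteq> \<eta> (int n - 1)" "d \<noteq> \<xi> 0" using third by blast
  define p where "p = 2 * int n + 2"
  \<comment> \<open>One period: the block of \<xi> at positions 0 to \<open>n - 1\<close>, the joint
    \<open>c\<close> at \<open>n\<close>, the block of \<eta> at \<open>n + 1\<close> to
    \<open>2 * n\<close>, and \<open>d\<close> at \<open>2 * n + 1\<close>, which closes up with
    \<open>\<xi> 0\<close>.\<close>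
  define w where "w k = (if k < int n then \<xi> k else if k = int n then c
    else if k \<le> 2 * int n then \<eta> (k - int n - 1) else d)" for k
  define \<zeta> where "\<zeta> j = w (j mod p)" for j
  have sym: "\<xi> i \<in> {1..s}" "\<xi> i \<noteq> \<xi> (i + 1)" "\<eta> i \<in> {1..s}" "\<eta> i \<noteq> \<eta> (i + 1)" for i
    using \<xi> \<eta> unfolding Sigma_sym_def by blast+
  have w_adm: "w k \<noteq> w (k + 1)" if k: "0 \<le> k" "k + 1 < p" for k
  proof -
    consider "k < int n - 1" | "k = int n - 1" | "k = int n" | "int n < k" "k < 2 * int n" | "k = 2 * int n"
      using k unfolding p_def by linarith
    thus ?thesis
    proof cases
      case 4
      thus ?thesis using sym(4)[of "k - int n - 1"] by (simp add: w_def algebra_simps)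
    qed (use sym(2)[of k] c d n in \<open>auto simp: w_def\<close>)
  qed
  have w_end: "w (p - 1) \<noteq> w 0" using d n by (simp add: w_def p_def)
  have "\<zeta> j \<noteq> \<zeta> (j + 1)" for j
  proof -
    define k where "k = j mod p"
    have k: "0 \<le> k" "k < p" by (simp_all add: k_def p_def)
    have "(j + 1) mod p = (k + 1) mod p" by (simp add: k_def mod_add_left_eq)
    also have "\<dots> = (if k + 1 = p then 0 else k + 1)" using k by simp
    finally show ?thesis
      using w_adm[of k] w_end k by (auto simp: \<zeta>_def k_def[symmetric])
  qed
  moreover have "w k \<in> {1..s}" for k unfolding w_def using sym(1,3) c(1) d(1) by simp
  ultimately have "\<zeta> \<in> Sigma_sym s" unfolding Sigma_sym_def by (auto simp: \<zeta>_def)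
  moreover have "(shift ^^ (2 * n + 2)) \<zeta> = \<zeta>"
  proof
    fix j
    have "(shift ^^ (2 * n + 2)) \<zeta> j = \<zeta> (j + p)" unfolding shift_funpow p_def by (simp add: add.commute)
    thus "(shift ^^ (2 * n + 2)) \<zeta> j = \<zeta> j" by (simp add: \<zeta>_def)
  qed
  moreover have "\<zeta> i = \<xi> i" if "0 \<le> i" "i < int n" for i
    using that by (simp add: \<zeta>_def w_def p_def)
  moreover have "\<zeta> (int n + 1 + i) = \<eta> i" if "0 \<le> i" "i < int n" for i
    using that by (simp add: \<zeta>_def w_def p_def)
  ultimately show ?thesis using that by blast
qed

text \<open>Equal block lengths give both sequences the same weight, hence the midpoint. Block ends
  and joints contribute an error bounded independently of \<open>n\<close>, which a long block makes
  negligible.\<close>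

lemma periodic_average_near_midpoint:
  fixes f :: "(int \<Rightarrow> nat) \<Rightarrow> 'a::real_normed_vector"
  assumes s: "s \<ge> 3" and bound: "\<And>\<xi>. \<xi> \<in> Sigma_sym s \<Longrightarrow> norm (f \<xi>) \<le> M"
    and unif: "\<And>\<epsilon>. \<epsilon> > 0 \<Longrightarrow> \<exists>m::nat. \<forall>\<xi>\<in>Sigma_sym s. \<forall>\<eta>\<in>Sigma_sym s.
      (\<forall>i. \<bar>i\<bar> \<le> int m \<longrightarrow> \<xi> i = \<eta> i) \<longrightarrow> dist (f \<xi>) (f \<eta>) < \<epsilon>"
    and \<xi>: "\<xi> \<in> Sigma_sym s" "(\<lambda>n. (1 / real n) *\<^sub>R (\<Sum>i<n. f ((shift ^^ i) \<xi>))) \<longlonglongrightarrow> a"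
    and \<eta>: "\<eta> \<in> Sigma_sym s" "(\<lambda>n. (1 / real n) *\<^sub>R (\<Sum>i<n. f ((shift ^^ i) \<eta>))) \<longlonglongrightarrow> b"
    and "\<epsilon> > 0"
  obtains \<zeta> r where "\<zeta> \<in> Sigma_sym s" "periodic_seq \<zeta>"
    "(\<lambda>n. (1 / real n) *\<^sub>R (\<Sum>i<n. f ((shift ^^ i) \<zeta>))) \<longlonglongrightarrow> r" "dist r (midpoint a b) < \<epsilon>"
proof -
  define e where "e = \<epsilon> / 3"
  have e: "e > 0" using \<open>\<epsilon> > 0\<close> by (simp add: e_def)
  obtain m :: nat where m: "\<forall>\<xi>\<in>Sigma_sym s. \<forall>\<eta>\<in>Sigma_sym s.
      (\<forall>i. \<bar>i\<bar> \<le> int m \<longrightarrow> \<xi> i = \<eta> i) \<longrightarrow> dist (f \<xi>) (f \<eta>) < e"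
    using unif[OF e] by blast
  have m': "dist (f \<xi>) (f \<eta>) \<le> e" if "\<xi> \<in> Sigma_sym s" "\<eta> \<in> Sigma_sym s"
    "\<And>i. \<bar>i\<bar> \<le> int m \<Longrightarrow> \<xi> i = \<eta> i" for \<xi> \<eta>
    using m that by (simp add: less_imp_le)
  \<comment> \<open>Twice \<open>4 * real m * M\<close> for the block ends, \<open>M\<close> for
    each of the two joints, and \<open>a + b\<close> because half the period is \<open>n + 1\<close>
    instead of \<open>n\<close>.\<close>
  define C where "C = 8 * real m * M + 2 * M + norm (a + b)"
  define A where "A \<xi> n = (\<Sum>i<n. f ((shift ^^ i) \<xi>))" for \<xi> n
  have "\<forall>\<^sub>F n in sequentially. dist ((1 / real n) *\<^sub>R A \<xi> n) a < e"
    "\<forall>\<^sub>F n in sequentially. dist ((1 / real n) *\<^sub>R A \<eta> n) b < e"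
    unfolding A_def using tendstoD[OF \<xi>(2) e] tendstoD[OF \<eta>(2) e] .
  moreover have "\<forall>\<^sub>F n in sequentially. real n > C / e"
    using filterlim_real_sequentially filterlim_at_top_dense by blast
  ultimately have "\<forall>\<^sub>F n in sequentially. n > 0 \<and> real n > C / e \<and>
    dist ((1 / real n) *\<^sub>R A \<xi> n) a < e \<and> dist ((1 / real n) *\<^sub>R A \<eta> n) b < e"
    using eventually_gt_at_top[of 0] by eventually_elim blast
  then obtain n where n: "n > 0" "real n > C / e"
    "dist ((1 / real n) *\<^sub>R A \<xi> n) a < e" "dist ((1 / real n) *\<^sub>R A \<eta> n) b < e"
    using eventually_happens'[OF sequentially_bot] by blast
  have avg: "norm (A \<theta> n - real n *\<^sub>R v) \<le> real n * e"
    if "dist ((1 / real n) *\<^sub>R A \<theta> n) v < e" for \<theta> v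
  proof -
    have "A \<theta> n - real n *\<^sub>R v = real n *\<^sub>R ((1 / real n) *\<^sub>R A \<theta> n - v)"
      using n(1) by (simp add: scaleR_diff_right)
    also have "norm \<dots> \<le> real n * e" using that by (simp add: dist_norm mult_left_mono)
    finally show ?thesis .
  qed
  define p where "p = 2 * n + 2"
  obtain \<zeta> where \<zeta>: "\<zeta> \<in> Sigma_sym s" "(shift ^^ p) \<zeta> = \<zeta>"
    "\<And>i. 0 \<le> i \<Longrightarrow> i < int n \<Longrightarrow> \<zeta> i = \<xi> i"
    "\<And>i. 0 \<le> i \<Longrightarrow> i < int n \<Longrightarrow> \<zeta> (int n + 1 + i) = \<eta> i"
    using periodic_concatenation[OF s \<xi>(1) \<eta>(1) n(1)] unfolding p_def by metis
  define g where "g i = f ((shift ^^ i) \<zeta>)" for i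
  define X where "X = (\<Sum>i<n. g i) - A \<xi> n"
  define Y where "Y = (\<Sum>i<n. g (n + 1 + i)) - A \<eta> n"
  have block: "norm ((\<Sum>i<n. g (k + i)) - A \<theta> n) \<le> real n * e + 4 * real m * M"
    if \<theta>: "\<theta> \<in> Sigma_sym s"
      and agree: "\<And>i. 0 \<le> i \<Longrightarrow> i < int n \<Longrightarrow> \<zeta> (int k + i) = \<theta> i" for \<theta> k
    unfolding g_def A_def
  proof (rule orbit_sum_block_le[where s = s and f = f])
    show "0 \<le> e" using e by simp
  qed (fact bound m' \<theta> \<zeta>(1) agree)+
  have X: "norm X \<le> real n * e + 4 * real m * M"
    unfolding X_def using block[OF \<xi>(1), of 0] \<zeta>(3) by simp
  have Y: "norm Y \<le> real n * e + 4 * real m * M"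
    unfolding Y_def using block[OF \<eta>(1), of "n + 1"] \<zeta>(4) by (simp add: add.commute)
  have gM: "norm (g i) \<le> M" for i unfolding g_def by (intro bound shift_funpow_Sigma \<zeta>)
  have "(\<Sum>i<p. g i) = (\<Sum>i<(n + 1) + (n + 1). g i)" by (simp add: p_def mult_2)
  also have "\<dots> = (\<Sum>i<n. g i) + g n + ((\<Sum>i<n. g (n + 1 + i)) + g (2 * n + 1))"
    unfolding sum_lessThan_append[of g "n + 1"] by (simp add: mult_2)
  finally have split: "(\<Sum>i<p. g i) = (\<Sum>i<n. g i) + g n + ((\<Sum>i<n. g (n + 1 + i)) + g (2 * n + 1))" .
  define r where "r = (1 / real p) *\<^sub>R (\<Sum>i<p. g i)"
  have mid: "real p *\<^sub>R midpoint a b = real n *\<^sub>R a + real n *\<^sub>R b + (a + b)"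
    by (simp add: p_def midpoint_def algebra_simps)
  have "real p *\<^sub>R (r - midpoint a b) = (\<Sum>i<p. g i) - real p *\<^sub>R midpoint a b"
    by (simp add: r_def scaleR_diff_right p_def)
  also have "\<dots> = X + Y + (g n + g (2 * n + 1)) + (A \<xi> n - real n *\<^sub>R a) + (A \<eta> n - real n *\<^sub>R b) - (a + b)"
    unfolding split mid X_def Y_def by simp
  also have "norm \<dots> \<le> norm X + norm Y + (norm (g n) + norm (g (2 * n + 1)))
      + norm (A \<xi> n - real n *\<^sub>R a) + norm (A \<eta> n - real n *\<^sub>R b) + norm (a + b)"
    by (rule order_refl | rule add_mono | rule norm_triangle_le | rule norm_triangle_le_diff)+
  \<comment> \<open>Two block comparisons and two averages contribute \<open>real n * e\<close>
    each, and the choice of \<open>n\<close> puts \<open>C\<close> below a fifth such term. As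
    \<open>e\<close> is a third of \<epsilon>, five of them stay below
    \<open>real p * \<epsilon>\<close>.\<close>
  also have "\<dots> \<le> 4 * (real n * e) + C"
    using X Y gM[of n] gM[of "2 * n + 1"] avg[OF n(3)] avg[OF n(4)] unfolding C_def by linarith
  also have "\<dots> < 5 * (real n * e)" using n(2) e by (simp add: field_simps)
  also have "\<dots> \<le> real p * \<epsilon>" using e by (simp add: p_def e_def field_simps)
  finally have "real p * norm (r - midpoint a b) < real p * \<epsilon>" by simp
  hence "dist r (midpoint a b) < \<epsilon>" by (simp add: p_def dist_norm)
  moreover have "periodic_seq \<zeta>" unfolding periodic_seq_def using \<zeta>(2) by (intro exI[of _ p]) (simp add: p_def)
  moreover have "(\<lambda>n. (1 / real n) *\<^sub>R (\<Sum>i<n. g i)) \<longlonglongrightarrow> r" unfolding r_def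
  proof (rule periodic_average_tendsto)
    show "g (i + p) = g i" for i unfolding g_def funpow_add comp_apply \<zeta>(2) ..
  qed (simp add: p_def)
  ultimately show ?thesis using that \<zeta>(1) unfolding g_def by blast
qed

section \<open>From midpoints to convexity and density\<close>

text \<open>Bisection: \<open>z\<close> lies in one half of the segment, whose ends are again in
  \<open>C\<close>. Repeated halving brings points of \<open>C\<close> arbitrarily close to
  \<open>z\<close>, and \<open>C\<close> is closed.\<close>

lemma closed_midpoint_convex:
  fixes C :: "'a::euclidean_space set"
  assumes "closed C" and mid: "\<And>x y. x \<in> C \<Longrightarrow> y \<in> C \<Longrightarrow> midpoint x y \<in> C"
  shows "convex C"
proof -
  have bisect: "\<exists>c\<in>C. dist c z \<le> dist x y / 2 ^ n"
    if "x \<in> C" "y \<in> C" "z \<in> closed_segment x y" for x y z n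
    using that
  proof (induction n arbitrary: x y)
    case 0
    thus ?case using segment_bound(1)[of z x y] by (auto simp: dist_norm norm_minus_commute)
  next
    case (Suc n)
    have "closed_segment x y = closed_segment x (midpoint x y) \<union> closed_segment (midpoint x y) y"
      by (rule Un_closed_segment[OF midpoint_in_closed_segment, symmetric])
    hence "z \<in> closed_segment x (midpoint x y) \<or> z \<in> closed_segment (midpoint x y) y"
      using Suc.prems(3) by blast
    thus ?case
    proof
      assume "z \<in> closed_segment x (midpoint x y)"
      from Suc.IH[OF Suc.prems(1) mid[OF Suc.prems(1,2)] this] show ?thesis
        by (simp add: dist_midpoint)
    next
      assume "z \<in> closed_segment (midpoint x y) y"
      from Suc.IH[OF mid[OF Suc.prems(1,2)] Suc.prems(2) this] show ?thesis
        by (simp add: dist_midpoint)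
    qed
  qed
  have "z \<in> C" if xyz: "x \<in> C" "y \<in> C" "z \<in> closed_segment x y" for x y z
  proof -
    have "z \<in> closure C" unfolding closure_approachable
    proof (intro allI impI)
      fix e :: real assume "e > 0"
      have "(\<lambda>n. dist x y * (1 / 2) ^ n) \<longlonglongrightarrow> dist x y * 0"
        by (intro tendsto_intros LIMSEQ_power_zero) simp
      hence "\<forall>\<^sub>F n in sequentially. dist x y * (1 / 2) ^ n < e"
        using \<open>e > 0\<close> by (intro order_tendstoD) auto
      then obtain n where "dist x y * (1 / 2) ^ n < e"
        using eventually_happens'[OF sequentially_bot] by blast
      hence "dist x y / 2 ^ n < e" by (simp add: power_divide)
      thus "\<exists>c\<in>C. dist c z < e" using bisect[OF xyz, of n] by (blast intro: le_less_trans)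
    qed
    thus ?thesis using \<open>closed C\<close> by simp
  qed
  thus ?thesis unfolding convex_contains_segment by blast
qed

theorem theorem2:
  fixes s :: nat and K :: "nat \<Rightarrow> 'a::euclidean_space set"
  assumes "DIM('a) \<ge> 2" and "s \<ge> 3" and "open_billiard_config s K"
  shows "convex (closure (J_phi s K)) \<and> J_phi s K \<subseteq> closure (P_phi s K)"
proof
  define Per where "Per = {r. \<exists>\<xi>\<in>Sigma_sym s. periodic_seq \<xi> \<and> has_rotation_vector s K \<xi> r}"
  obtain M where M: "\<And>i p. i \<in> {1..s} \<Longrightarrow> p \<in> K i \<Longrightarrow> norm p \<le> M"
    using obstacles_bounded[OF assms(3)] by blast
  have bound: "norm (phi_billiard s K \<xi>) \<le> M" if "\<xi> \<in> Sigma_sym s" for \<xi>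
    using M[OF Sigma_symD(1)[OF that] phi_billiard_mem[OF assms(3) that]] .
  \<comment> \<open>This serves both claims: arbitrary \<open>a\<close> and \<open>b\<close> give
    convexity, and \<open>a = b\<close> gives density, since the midpoint is then \<open>a\<close>
    itself.\<close>
  have near: "\<exists>r\<in>Per. dist r (midpoint a b) < \<epsilon>"
    if ab: "a \<in> J_phi s K" "b \<in> J_phi s K" and "\<epsilon> > 0" for a b \<epsilon>
  proof -
    obtain \<xi> where \<xi>: "\<xi> \<in> Sigma_sym s" "has_rotation_vector s K \<xi> a" using ab(1) unfolding J_phi_def by blast
    obtain \<eta> where \<eta>: "\<eta> \<in> Sigma_sym s" "has_rotation_vector s K \<eta> b" using ab(2) unfolding J_phi_def by blast
    obtain \<zeta> r where "\<zeta> \<in> Sigma_sym s" "periodic_seq \<zeta>" "has_rotation_vector s K \<zeta> r"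
      "dist r (midpoint a b) < \<epsilon>"
      using periodic_average_near_midpoint[where f = "phi_billiard s K",
          OF assms(2) bound phi_billiard_uniform[OF assms(3)] \<xi>(1) \<xi>(2)[unfolded has_rotation_vector_def]
          \<eta>(1) \<eta>(2)[unfolded has_rotation_vector_def] \<open>\<epsilon> > 0\<close>]
      unfolding has_rotation_vector_def by blast
    thus ?thesis unfolding Per_def by blast
  qed
  have Per_J: "Per \<subseteq> J_phi s K" unfolding Per_def J_phi_def by blast
  show "convex (closure (J_phi s K))"
  proof (rule closed_midpoint_convex)
    fix x y assume xy: "x \<in> closure (J_phi s K)" "y \<in> closure (J_phi s K)"
    show "midpoint x y \<in> closure (J_phi s K)" unfolding closure_approachable
    proof (intro allI impI)
      fix e :: real assume e: "e > 0"
      obtain a where a: "a \<in> J_phi s K" "dist a x < e / 2"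
        using xy(1) e unfolding closure_approachable by (meson half_gt_zero)
      obtain b where b: "b \<in> J_phi s K" "dist b y < e / 2"
        using xy(2) e unfolding closure_approachable by (meson half_gt_zero)
      \<comment> \<open>The midpoint of \<open>a\<close> and \<open>b\<close> need not lie in
        \<open>J_phi s K\<close>, but \<open>r\<close> does, by \<open>Per_J\<close>.\<close>
      obtain r where r: "r \<in> Per" "dist r (midpoint a b) < e / 2"
        using near[OF a(1) b(1), of "e / 2"] e by auto
      have "midpoint a b - midpoint x y = (1 / 2) *\<^sub>R ((a - x) + (b - y))"
        by (simp add: midpoint_def algebra_simps)
      hence "dist (midpoint a b) (midpoint x y) \<le> (dist a x + dist b y) / 2"
        using norm_triangle_ineq[of "a - x" "b - y"] by (simp add: dist_norm)
      also have "\<dots> < e / 2" using a(2) b(2) by simp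
      finally have "dist (midpoint x y) (midpoint a b) < e / 2" by (simp add: dist_commute)
      from dist_triangle_lt[OF add_strict_mono[OF r(2) this]]
      have "dist r (midpoint x y) < e" by simp
      thus "\<exists>r\<in>J_phi s K. dist r (midpoint x y) < e" using r(1) Per_J by blast
    qed
  qed simp
  show "J_phi s K \<subseteq> closure (P_phi s K)"
  proof
    fix a assume a: "a \<in> J_phi s K"
    have "a \<in> closure Per" unfolding closure_approachable using near[OF a a] by simp
    moreover have "closure Per \<subseteq> closure (P_phi s K)"
      unfolding P_phi_def Per_def by (intro closure_mono hull_subset)
    ultimately show "a \<in> closure (P_phi s K)" by blast
  qed
qed

end
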